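(* As $\epsilon\to0$, the random variables $c\,\epsilon^d\sqrt{\tau_\epsilon}$ converge in distribution to $\dfrac{\mathcal{E}}{|\mathcal{N}|}$, where $\mathcal{E}$ and $\mathcal{N}$ are two independent random variables, $\mathcal{E}$ having an exponential distribution of mean $1$ and $\mathcal{N}$ having a standard Gaussian distribution.
   Context: Let $d\ge 1$ be an integer. Let $(Y_n)_{n\ge 0}$ be a sequence of independent random variables, each uniformly distributed on $(0,1)^d$. Let $(S_n)_{n\ge 0}$ be the simple symmetric random walk on $\mathbb{Z}$: $S_0=0$ and $S_n=\sum_{k=1}^n X_k$, where $(X_k)_{k\ge1}$ are independent with $\mathbb{P}(X_k=1)=\mathbb{P}(X_k=-1)=1/2$. The sequences $(S_n)_{n\ge0}$ and $(Y_n)_{n\ge0}$ are independent of each other. Define the process $M_n:=(S_n,0)+Y_n\in\mathbb{R}\times(0,1)^{d-1}\subset\mathbb{R}^d$, where $(S_n,0)$ denotes the vector of $\mathbb{R}^d$ with first coordinate $S_n$ and all other coordinates $0$. Fix a norm on $\mathbb{R}^d$, let $B(x,\epsilon)$ denote the open ball of center $x$ and radius $\epsilon$ for this norm, and let $c$ be the Lebesgue measure of the unit ball. The first return time is $\tau_\epsilon:=\inf\{m\ge 1: M_m\in B(M_0,\epsilon)\}$. *)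

theory Defs
  imports "HOL-Probability.Probability"
begin

text \<open>
  An arbitrary norm on \<^typ>\<open>real^'n\<close>; the library only offers the fixed norm of a
  type class instance.
\<close>

definition is_norm :: "('v::real_vector \<Rightarrow> real) \<Rightarrow> bool" where
  "is_norm \<nu> \<longleftrightarrow>
     (\<forall>x. \<nu> x = 0 \<longleftrightarrow> x = 0) \<and>
     (\<forall>a x. \<nu> (a *\<^sub>R x) = \<bar>a\<bar> * \<nu> x) \<and>
     (\<forall>x y. \<nu> (x + y) \<le> \<nu> x + \<nu> y)"

definition norm_ball :: "('v::real_vector \<Rightarrow> real) \<Rightarrow> 'v \<Rightarrow> real \<Rightarrow> 'v set" where
  "norm_ball \<nu> x \<epsilon> = {y. \<nu> (y - x) < \<epsilon>}"

definition open_unit_cube :: "(real^'n) set" where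
  "open_unit_cube = {y. \<forall>i. 0 < y $ i \<and> y $ i < 1}"

definition walk :: "(nat \<Rightarrow> 'a \<Rightarrow> int) \<Rightarrow> nat \<Rightarrow> 'a \<Rightarrow> int" where
  "walk X n \<omega> = (\<Sum>k=1..n. X k \<omega>)"

text \<open>The index \<open>i0\<close> plays the role of the first coordinate.\<close>

definition strip_process ::
  "'n \<Rightarrow> (nat \<Rightarrow> 'a \<Rightarrow> int) \<Rightarrow> (nat \<Rightarrow> 'a \<Rightarrow> real^'n) \<Rightarrow> nat \<Rightarrow> 'a \<Rightarrow> real^'n" where
  "strip_process i0 X Y n \<omega> = axis i0 (real_of_int (walk X n \<omega>)) + Y n \<omega>"

text \<open>The infimum is taken in \<^typ>\<open>enat\<close>, so it is \<open>\<infinity>\<close> if the process never returns.\<close>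

definition return_time ::
  "('v::real_vector \<Rightarrow> real) \<Rightarrow> (nat \<Rightarrow> 'a \<Rightarrow> 'v) \<Rightarrow> real \<Rightarrow> 'a \<Rightarrow> enat" where
  "return_time \<nu> Z \<epsilon> \<omega> =
     (INF m\<in>{m. 1 \<le> m \<and> Z m \<omega> \<in> norm_ball \<nu> (Z 0 \<omega>) \<epsilon>}. enat m)"

definition sqrt_enat :: "enat \<Rightarrow> ereal" where
  "sqrt_enat t = (case t of enat n \<Rightarrow> ereal (sqrt (real n)) | \<infinity> \<Rightarrow> \<infinity>)"

text \<open>
  Convergence in distribution along a filter to a law \<open>\<mu>\<close> on the reals, i.e. pointwise
  convergence of the distribution functions at the continuity points of \<^term>\<open>cdf \<mu>\<close>.
  Compared with \<^const>\<open>weak_conv_m\<close>, an arbitrary filter replaces \<^const>\<open>sequentially\<close>,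
  and the variables may take the value \<open>\<infinity>\<close> (which is never \<open>\<le> x\<close>).
  For real-valued sequences the two notions agree; see the lemma below.
\<close>

definition converges_in_distribution ::
  "'a measure \<Rightarrow> ('i \<Rightarrow> 'a \<Rightarrow> ereal) \<Rightarrow> real measure \<Rightarrow> 'i filter \<Rightarrow> bool" where
  "converges_in_distribution M Z \<mu> F \<longleftrightarrow>
     (\<forall>\<^sub>F i in F. Z i \<in> borel_measurable M) \<and>
     (\<forall>x. isCont (cdf \<mu>) x \<longrightarrow>
        ((\<lambda>i. measure M {\<omega> \<in> space M. Z i \<omega> \<le> ereal x}) \<longlongrightarrow> cdf \<mu> x) F)"

lemma converges_in_distribution_iff_weak_conv_m:
  fixes Z :: "nat \<Rightarrow> 'a \<Rightarrow> real"
  assumes "\<And>n. Z n \<in> borel_measurable M"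
  shows "converges_in_distribution M (\<lambda>n \<omega>. ereal (Z n \<omega>)) \<mu> sequentially \<longleftrightarrow>
         weak_conv_m (\<lambda>n. distr M borel (Z n)) \<mu>"
proof -
  have "cdf (distr M borel (Z n)) x = measure M {\<omega> \<in> space M. Z n \<omega> \<le> x}" for n x
    using assms[of n] unfolding cdf_def
    by (subst measure_distr) (auto intro!: arg_cong[where f = "measure M"])
  then show ?thesis
    using assms by (simp add: converges_in_distribution_def weak_conv_m_def weak_conv_def)
qed

end

theory Submission
  imports Defs
begin

text \<open>
  Let \<open>L\<^sub>n\<close> be the number of times \<open>1 \<le> m \<le> n\<close> with \<open>S\<^sub>m = 0\<close>, and let \<open>d\<close> be the dimension.
  If \<open>Y\<^sub>0\<close> is at distance more than a constant times \<open>\<epsilon>\<close> from the boundary of the unit cube, then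
  \<open>B(Y\<^sub>0, \<epsilon>)\<close> lies inside the cube. Since distinct integer translates of the
  open cube are disjoint, \<open>M\<^sub>m\<close> can enter this ball only when \<open>S\<^sub>m = 0\<close>, and then it does so with probability
  \<open>c \<epsilon>^d\<close>, independently for different \<open>m\<close>. Conditionally on the walk, the probability that there is
  no return up to time \<open>n\<close> is therefore \<open>(1 - c \<epsilon>^d)^L\<^sub>n\<close> (\<open>prob_no_return_inner\<close>). The
  exceptional boundary layer has probability tending to 0, so the proof reduces to the limit of
  the expectation of \<open>(1 - c \<epsilon>^d)^L\<^sub>n\<close> when \<open>n\<close> is about \<open>(t / (c \<epsilon>^d))\<^sup>2\<close>, i.e. when \<open>c \<epsilon>^d \<surd>n \<rightarrow> t\<close>.

  This limit is the expectation of \<open>exp (- t |N|)\<close>, which is \<open>P(E > t |N|)\<close>, because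
  \<open>L\<^sub>n / \<surd>n\<close> converges in law to \<open>|N|\<close>. The latter comes from the exact identity
  \<open>P(L\<^sub>n < r) = P(- r \<le> S\<^bsub>n - r\<^esub> < r)\<close> (\<open>prob_card_returns_less\<close>), which turns the number of
  returns into a marginal of the walk, to which the central limit theorem applies. Probabilistically
  the identity combines two facts: each return to 0 takes one step away from 0 followed by a
  passage across one level, so the \<open>r\<close>-th return happens at time \<open>r\<close> plus the hitting time of the
  level \<open>r\<close>; and the reflection principle gives the law of that hitting time. It is proved here by
  checking that the resulting closed form satisfies the one-step recursion of the walk.

  Passing from the law of \<open>L\<^sub>n\<close> to the expectation of a power, and rewriting the law of
  \<open>E / |N|\<close>, both integrate \<open>P(T < u)\<close> over \<open>u\<close> against the standard exponential law: the result is at once the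
  expectation of \<open>exp (- T)\<close> and, for \<open>T\<close> independent of \<open>E\<close>, the probability \<open>P(T < E)\<close>.
  Hence pointwise convergence of distribution functions and dominated convergence suffice.
\<close>

section \<open>Returns of the simple random walk to the origin\<close>

locale simple_random_walk = prob_space M for M :: "'a measure" +
  fixes X :: "nat \<Rightarrow> 'a \<Rightarrow> int"
  assumes indep_steps: "indep_vars (\<lambda>_. count_space UNIV) X {1..}"
    and prob_step_up: "1 \<le> k \<Longrightarrow> prob {\<omega> \<in> space M. X k \<omega> = 1} = 1 / 2"
    and prob_step_down: "1 \<le> k \<Longrightarrow> prob {\<omega> \<in> space M. X k \<omega> = - 1} = 1 / 2"
begin

text \<open>The times at which the walk is back at 0. The set itself, and not only its cardinality, is kept
  because the points \<open>Y m\<close> that matter for the return time are those indexed by it.\<close>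

definition returns :: "nat \<Rightarrow> 'a \<Rightarrow> nat set" where
  "returns n \<omega> = {m \<in> {1..n}. walk X m \<omega> = 0}"

lemma measurable_step: "1 \<le> k \<Longrightarrow> X k \<in> measurable M (count_space UNIV)"
  using indep_steps by (auto simp: indep_vars_def)

lemma measurable_walk: "walk X k \<in> measurable M (count_space UNIV)"
proof (induction k)
  case 0
  show ?case by (simp add: walk_def)
next
  case (Suc k)
  have [measurable]: "X (Suc k) \<in> measurable M (count_space UNIV)" "walk X k \<in> measurable M (count_space UNIV)"
    using measurable_step Suc by auto
  have eq: "walk X (Suc k) = (\<lambda>\<omega>. walk X k \<omega> + X (Suc k) \<omega>)"
    by (simp add: walk_def fun_eq_iff)
  show ?case unfolding eq by measurable
qed

lemma measurable_returns: "returns n \<in> measurable M (count_space UNIV)"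
proof -
  note [measurable] = measurable_walk
  have "returns n \<in> measurable M (count_space (Pow {1..n}))"
  proof (subst measurable_count_space_eq_countable)
    show "countable (Pow {1..n})" by (auto intro: countable_finite)
    have "returns n \<omega> = J \<longleftrightarrow> (\<forall>m\<in>{1..n}. walk X m \<omega> = 0 \<longleftrightarrow> m \<in> J)" if "J \<subseteq> {1..n}" for J \<omega>
      using that unfolding returns_def set_eq_iff by blast
    then have "returns n -` {J} \<inter> space M = {\<omega> \<in> space M. \<forall>m\<in>{1..n}. walk X m \<omega> = 0 \<longleftrightarrow> m \<in> J}" if "J \<subseteq> {1..n}" for J
      using that by (simp add: vimage_def Int_def conj_commute)
    moreover have "{\<omega> \<in> space M. \<forall>m\<in>{1..n}. walk X m \<omega> = 0 \<longleftrightarrow> m \<in> J} \<in> sets M" for J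
      by measurable
    ultimately have "\<forall>a\<in>Pow {1..n}. returns n -` {a} \<inter> space M \<in> sets M"
      by simp
    then show "returns n \<in> space M \<rightarrow> Pow {1..n} \<and> (\<forall>a\<in>Pow {1..n}. returns n -` {a} \<inter> space M \<in> sets M)"
      by (auto simp: returns_def)
  qed
  then show ?thesis
    by (rule measurable_compose) simp
qed

lemma finite_returns [simp]: "finite (returns n \<omega>)"
  by (simp add: returns_def)

text \<open>On finitely many integer coordinates the product \<open>\<sigma>\<close>-algebra is discrete, so any function of the
  past steps whatsoever is independent of the next step.\<close>

lemma indep_past_step:
  fixes f :: "(nat \<Rightarrow> int) \<Rightarrow> real" and g :: "int \<Rightarrow> real"
  shows "indep_var borel (\<lambda>\<omega>. f (restrict (\<lambda>i. X i \<omega>) {1..k})) borel (\<lambda>\<omega>. g (X (Suc k) \<omega>))"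
proof -
  have "indep_var (PiM {1..k} (\<lambda>_. count_space UNIV)) (\<lambda>\<omega>. restrict (\<lambda>i. X i \<omega>) {1..k})
      (PiM {Suc k} (\<lambda>_. count_space UNIV)) (\<lambda>\<omega>. restrict (\<lambda>i. X i \<omega>) {Suc k})"
    by (rule indep_var_restrict[OF indep_steps]) auto
  moreover have "h \<in> borel_measurable (PiM A (\<lambda>_. count_space (UNIV :: int set)))"
    if "finite A" for h :: "(nat \<Rightarrow> int) \<Rightarrow> real" and A
    using that by (subst count_space_PiM_finite) auto
  ultimately have "indep_var borel (f \<circ> (\<lambda>\<omega>. restrict (\<lambda>i. X i \<omega>) {1..k})) borel
      ((\<lambda>x. g (x (Suc k))) \<circ> (\<lambda>\<omega>. restrict (\<lambda>i. X i \<omega>) {Suc k}))"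
    by (rule indep_var_compose) auto
  then show ?thesis by (simp add: comp_def)
qed

lemma AE_step:
  assumes "1 \<le> k"
  shows "AE \<omega> in M. X k \<omega> = 1 \<or> X k \<omega> = - 1"
proof (subst prob_Collect_eq_1[symmetric])
  note [measurable] = measurable_step[OF assms]
  show "{\<omega> \<in> space M. X k \<omega> = 1 \<or> X k \<omega> = - 1} \<in> events" by measurable
  have "{\<omega> \<in> space M. X k \<omega> = 1 \<or> X k \<omega> = - 1} = {\<omega> \<in> space M. X k \<omega> = 1} \<union> {\<omega> \<in> space M. X k \<omega> = - 1}"
    by auto
  also have "prob \<dots> = 1 / 2 + 1 / 2"
    by (subst finite_measure_Union) (auto simp: prob_step_up[OF assms] prob_step_down[OF assms])
  finally show "prob {\<omega> \<in> space M. X k \<omega> = 1 \<or> X k \<omega> = - 1} = 1" by simp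
qed

text \<open>The Markov property in the form in which it is used: average over the two values of the next
  step while the past is left untouched.\<close>

lemma expectation_one_step:
  fixes h :: "(nat \<Rightarrow> int) \<Rightarrow> int \<Rightarrow> real"
  assumes bounded: "\<And>p s. \<bar>h p s\<bar> \<le> B"
  assumes past_def: "past = (\<lambda>\<omega>. restrict (\<lambda>i. X i \<omega>) {1..k})"
  shows "expectation (\<lambda>\<omega>. h (past \<omega>) (X (Suc k) \<omega>)) =
    (expectation (\<lambda>\<omega>. h (past \<omega>) 1) + expectation (\<lambda>\<omega>. h (past \<omega>) (- 1))) / 2"
proof -
  note [measurable] = measurable_step[of "Suc k", simplified]
  have hm [measurable]: "(\<lambda>\<omega>. h (past \<omega>) s) \<in> borel_measurable M" for s
    using indep_past_step[of "\<lambda>p. h p s" k "\<lambda>_. 0"] unfolding past_def by (rule indep_var_rv1)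
  have int: "integrable M (\<lambda>\<omega>. h (past \<omega>) s)" for s
    by (rule integrable_const_bound[where B=B]) (auto simp: bounded)
  have ind [measurable]: "(\<lambda>\<omega>. indicator {s} (X (Suc k) \<omega>) :: real) \<in> borel_measurable M" for s
    by (rule measurable_compose[OF measurable_step[of "Suc k"]]) auto
  have split: "integrable M (\<lambda>\<omega>. h (past \<omega>) s * indicator {s} (X (Suc k) \<omega>)) \<and>
      expectation (\<lambda>\<omega>. h (past \<omega>) s * indicator {s} (X (Suc k) \<omega>)) = expectation (\<lambda>\<omega>. h (past \<omega>) s) / 2"
    if s: "s = 1 \<or> s = - 1" for s
  proof -
    have ind: "indep_var borel (\<lambda>\<omega>. h (past \<omega>) s) borel (\<lambda>\<omega>. indicator {s} (X (Suc k) \<omega>) :: real)"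
      unfolding past_def by (rule indep_past_step)
    have int2: "integrable M (\<lambda>\<omega>. indicator {s} (X (Suc k) \<omega>) :: real)"
      by (rule integrable_const_bound[where B=1]) (auto simp: indicator_def)
    have "(\<lambda>\<omega>. indicator {s} (X (Suc k) \<omega>) :: real) = indicator {\<omega>. X (Suc k) \<omega> = s}"
      by (auto simp: indicator_def)
    then have "expectation (\<lambda>\<omega>. indicator {s} (X (Suc k) \<omega>)) = prob {\<omega> \<in> space M. X (Suc k) \<omega> = s}"
      by (simp add: Int_def conj_commute)
    also have "\<dots> = 1 / 2"
      using s prob_step_up[of "Suc k"] prob_step_down[of "Suc k"] by auto
    finally have half: "expectation (\<lambda>\<omega>. indicator {s} (X (Suc k) \<omega>)) = (1 / 2 :: real)" .
    show ?thesis
      using indep_var_lebesgue_integral[OF ind int[of s] int2] indep_var_integrable[OF ind int[of s] int2]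
      unfolding half by simp
  qed
  have "expectation (\<lambda>\<omega>. h (past \<omega>) (X (Suc k) \<omega>)) = expectation (\<lambda>\<omega>.
      h (past \<omega>) 1 * indicator {1} (X (Suc k) \<omega>) + h (past \<omega>) (- 1) * indicator {- 1} (X (Suc k) \<omega>))"
  proof (rule integral_cong_AE)
    have "(\<lambda>\<omega>. (\<lambda>s. h (past \<omega>) s) (X (Suc k) \<omega>)) \<in> borel_measurable M"
      by (rule measurable_compose_countable) measurable
    then show "(\<lambda>\<omega>. h (past \<omega>) (X (Suc k) \<omega>)) \<in> borel_measurable M" by simp
    show "AE \<omega> in M. h (past \<omega>) (X (Suc k) \<omega>) =
      h (past \<omega>) 1 * indicator {1} (X (Suc k) \<omega>) + h (past \<omega>) (- 1) * indicator {- 1} (X (Suc k) \<omega>)"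
      using AE_step[of "Suc k"] by (auto elim!: eventually_mono)
  qed measurable
  also have "\<dots> = expectation (\<lambda>\<omega>. h (past \<omega>) 1) / 2 + expectation (\<lambda>\<omega>. h (past \<omega>) (- 1)) / 2"
    using split[of 1] split[of "- 1"] by simp
  finally show ?thesis by simp
qed

lemma walk_Suc: "walk X (Suc k) \<omega> = walk X k \<omega> + X (Suc k) \<omega>"
  by (simp add: walk_def)

lemma card_returns_Suc:
  "card (returns (Suc k) \<omega>) = card (returns k \<omega>) + (if walk X (Suc k) \<omega> = 0 then 1 else 0)"
proof -
  have "returns (Suc k) \<omega> = returns k \<omega> \<union> (if walk X (Suc k) \<omega> = 0 then {Suc k} else {})"
    by (auto simp: returns_def le_Suc_eq)
  moreover have "Suc k \<notin> returns k \<omega>" by (auto simp: returns_def)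
  ultimately show ?thesis by simp
qed

text \<open>The pair of current position and number of returns so far is a Markov chain.\<close>

lemma expectation_walk_step:
  fixes g :: "int \<Rightarrow> nat \<Rightarrow> real"
  assumes bounded: "\<And>s l. \<bar>g s l\<bar> \<le> B"
  shows "expectation (\<lambda>\<omega>. g (walk X (Suc k) \<omega>) (card (returns (Suc k) \<omega>))) =
    (expectation (\<lambda>\<omega>. g (walk X k \<omega> + 1) (card (returns k \<omega>) + (if walk X k \<omega> = - 1 then 1 else 0))) +
     expectation (\<lambda>\<omega>. g (walk X k \<omega> - 1) (card (returns k \<omega>) + (if walk X k \<omega> = 1 then 1 else 0)))) / 2"
proof -
  define past where "past \<equiv> \<lambda>\<omega>. restrict (\<lambda>i. X i \<omega>) {1..k}"
  define S where "S p = (\<Sum>i=1..k. p i)" for p :: "nat \<Rightarrow> int"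
  define L where "L p = card {m \<in> {1..k}. (\<Sum>i=1..m. p i) = 0}" for p :: "nat \<Rightarrow> int"
  have S: "S (past \<omega>) = walk X k \<omega>" for \<omega>
    by (simp add: S_def past_def walk_def)
  have L: "L (past \<omega>) = card (returns k \<omega>)" for \<omega>
    unfolding L_def past_def returns_def walk_def
    by (intro arg_cong[where f=card] Collect_cong conj_cong refl arg_cong2[where f="(=)"] sum.cong) auto
  show ?thesis
    using expectation_one_step[of "\<lambda>p s. g (S p + s) (L p + (if S p + s = 0 then 1 else 0))" B past k] bounded
    unfolding S L walk_Suc card_returns_Suc
    by (simp add: past_def add_eq_0_iff2)
qed

text \<open>By the reflection principle this is the probability that the walk has not hit the level \<open>h\<close> up to
  time \<open>m\<close>: it equals \<open>1 - P(S\<^sub>m \<ge> h) - P(S\<^sub>m > h)\<close>. The half-open interval gives the exact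
  boundary values: 0 for the level \<open>h = 0\<close>, which is hit at once, and 1 at time \<open>m = 0\<close> for every
  other level.\<close>

definition near :: "nat \<Rightarrow> nat \<Rightarrow> real" where
  "near h m = prob {\<omega> \<in> space M. - int h \<le> walk X m \<omega> \<and> walk X m \<omega> < int h}"

lemma near_0 [simp]: "near 0 m = 0"
proof -
  have "{\<omega> \<in> space M. - int 0 \<le> walk X m \<omega> \<and> walk X m \<omega> < int 0} = {}" by auto
  then show ?thesis unfolding near_def by (simp only: measure_empty)
qed

lemma near_start: "0 < h \<Longrightarrow> near h 0 = 1"
  by (simp add: near_def walk_def prob_space)

lemma near_bounds: "0 \<le> near h m" "near h m \<le> 1"
  by (auto simp: near_def)

text \<open>One step shifts the interval \<open>[-h-1, h+1)\<close> by \<open>1\<close> to the left or to the right. The two shifted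
  intervals have the four end points of \<open>[-h-2, h+2)\<close> and \<open>[-h, h)\<close>, so the sums of their
  probabilities agree. This is the equation satisfied by the probability of not having hit a level.\<close>

lemma near_Suc: "near (Suc h) (Suc m) = (near (Suc (Suc h)) m + near h m) / 2"
proof -
  note [measurable] = measurable_walk
  define I where "I a b = prob {\<omega> \<in> space M. a \<le> walk X m \<omega> \<and> walk X m \<omega> < b}" for a b
  define U where "U a = prob {\<omega> \<in> space M. walk X m \<omega> < a}" for a
  have I: "I a b = U b - U a" if "a \<le> b" for a b
  proof -
    have "{\<omega> \<in> space M. walk X m \<omega> < b} = {\<omega> \<in> space M. walk X m \<omega> < a} \<union> {\<omega> \<in> space M. a \<le> walk X m \<omega> \<and> walk X m \<omega> < b}"
      using that by auto
    also have "prob \<dots> = U a + I a b"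
      unfolding U_def I_def by (rule finite_measure_Union) auto
    finally show ?thesis by (simp add: U_def)
  qed
  have E: "expectation (\<lambda>\<omega>. (if a \<le> walk X m \<omega> + s \<and> walk X m \<omega> + s < b then 1 else 0)) = I (a - s) (b - s)" for a b s
  proof -
    have "(\<lambda>\<omega>. (if a \<le> walk X m \<omega> + s \<and> walk X m \<omega> + s < b then 1 else 0) :: real) =
      indicator {\<omega>. a - s \<le> walk X m \<omega> \<and> walk X m \<omega> < b - s}"
      by (auto simp: fun_eq_iff indicator_def)
    then show ?thesis by (simp add: I_def Int_def conj_ac)
  qed
  have "near (Suc h) (Suc m) = expectation (\<lambda>\<omega>. (if - int (Suc h) \<le> walk X (Suc m) \<omega> \<and> walk X (Suc m) \<omega> < int (Suc h) then 1 else 0))"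
  proof -
    have "(\<lambda>\<omega>. (if - int (Suc h) \<le> walk X (Suc m) \<omega> \<and> walk X (Suc m) \<omega> < int (Suc h) then 1 else 0) :: real) =
      indicator {\<omega>. - int (Suc h) \<le> walk X (Suc m) \<omega> \<and> walk X (Suc m) \<omega> < int (Suc h)}"
      by (auto simp: fun_eq_iff indicator_def)
    then show ?thesis by (simp add: near_def Int_def conj_ac)
  qed
  also have "\<dots> = (I (- int (Suc h) - 1) (int (Suc h) - 1) + I (- int (Suc h) - (- 1)) (int (Suc h) - (- 1))) / 2"
    using expectation_walk_step[of "\<lambda>s l. if - int (Suc h) \<le> s \<and> s < int (Suc h) then 1 else 0" 1 m]
    unfolding E[symmetric] by (simp add: algebra_simps)
  also have "\<dots> = (I (- int (Suc (Suc h))) (int (Suc (Suc h))) + I (- int h) (int h)) / 2"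
    by (simp add: I algebra_simps)
  finally show ?thesis by (simp add: near_def I_def)
qed

text \<open>The probability that a walk started at \<open>s\<close> visits 0 fewer than \<open>r\<close> times during its next \<open>n\<close>
  steps. From \<open>s \<noteq> 0\<close> the walk first has to cross \<open>|s|\<close> levels, and each of the \<open>r - 1\<close> further
  visits costs one step away from 0 and the crossing of one level; from \<open>s = 0\<close> each of the \<open>r\<close>
  visits costs this much.\<close>

definition few_returns :: "nat \<Rightarrow> int \<Rightarrow> nat \<Rightarrow> real" where
  "few_returns n s r =
    (if r = 0 then 0 else if s = 0 then near r (n - r) else near (nat \<bar>s\<bar> + r - 1) (n + 1 - r))"

lemma few_returns_bounds: "\<bar>few_returns n s r\<bar> \<le> 1"
  using near_bounds by (simp add: few_returns_def)

lemma few_returns_start: "few_returns 0 s r = (if r = 0 then 0 else 1)"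
  by (auto simp: few_returns_def near_start)

lemma near_step_remaining:
  assumes "1 \<le> r" "1 \<le> h"
  shows "near (h + r - 1) (n + 2 - r) = (near (h + r) (n + 1 - r) + near (h + r - 2) (n + 1 - r)) / 2"
proof (cases "r \<le> n + 1")
  case True
  then have "n + 2 - r = Suc (n + 1 - r)" by simp
  moreover have "h + r - 1 = Suc (h + r - 2)" "h + r = Suc (Suc (h + r - 2))" using assms by auto
  ultimately show ?thesis by (metis near_Suc)
next
  case False
  then have "n + 2 - r = 0" "n + 1 - r = 0" "h + r - 2 > 0" "h + r - 1 > 0" using assms by auto
  then show ?thesis by (simp add: near_start)
qed

text \<open>The recursion that characterises \<open>few_returns\<close> as such a probability: conditioning on the first
  step, a step to 0 uses up one of the allowed visits.\<close>

lemma few_returns_Suc: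
  "few_returns (Suc n) s r =
    (few_returns n (s + 1) (r - (if s = - 1 then 1 else 0)) +
     few_returns n (s - 1) (r - (if s = 1 then 1 else 0))) / 2"
proof (cases "r = 0")
  case True
  then show ?thesis by (simp add: few_returns_def)
next
  case r: False
  consider "s = 0" | "\<bar>s\<bar> = 1" | "2 \<le> \<bar>s\<bar>" by linarith
  then show ?thesis
  proof cases
    case 1
    then show ?thesis using r by (simp add: few_returns_def)
  next
    case 2
    have "few_returns n 0 (r - 1) = near (r - 1) (n + 1 - r)"
      using r by (simp add: few_returns_def)
    moreover have "few_returns n 2 r = near (1 + r) (n + 1 - r)" "few_returns n (- 2) r = near (1 + r) (n + 1 - r)"
      using r by (auto simp: few_returns_def)
    moreover have "few_returns (Suc n) s r = near r (n + 2 - r)"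
      using r 2 by (auto simp: few_returns_def)
    moreover have "s = 1 \<or> s = - 1" using 2 by linarith
    ultimately show ?thesis
      using near_step_remaining[of r 1 n] r by auto
  next
    case 3
    define h where "h = nat \<bar>s\<bar>"
    have h: "2 \<le> h" "s = int h \<or> s = - int h" using 3 by (auto simp: h_def)
    have up: "few_returns n s' r = near (h + r) (n + 1 - r)" if "s' = int h + 1 \<or> s' = - int h - 1" for s'
    proof -
      have "nat \<bar>s'\<bar> + r - 1 = h + r" "s' \<noteq> 0" using that by auto
      then show ?thesis using r by (simp add: few_returns_def)
    qed
    have down: "few_returns n s' r = near (h + r - 2) (n + 1 - r)" if "s' = int h - 1 \<or> s' = 1 - int h" for s'
    proof -
      have "nat \<bar>s'\<bar> + r - 1 = h + r - 2" "s' \<noteq> 0" using that h by auto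
      then show ?thesis using r by (simp add: few_returns_def)
    qed
    have "few_returns (Suc n) s r = near (h + r - 1) (n + 2 - r)"
      using r 3 by (auto simp: few_returns_def h_def)
    also have "\<dots> = (near (h + r) (n + 1 - r) + near (h + r - 2) (n + 1 - r)) / 2"
      using r h by (intro near_step_remaining) auto
    also have "\<dots> = (few_returns n (s + 1) r + few_returns n (s - 1) r) / 2"
      using h up[of "s + 1"] down[of "s + 1"] up[of "s - 1"] down[of "s - 1"] by auto
    finally show ?thesis using 3 by auto
  qed
qed

text \<open>By the recursion, \<open>few_returns (n - k) S\<^sub>k (r - L\<^sub>k)\<close> has constant expectation in \<open>k\<close>. At \<open>k = n\<close>
  it is the indicator of \<open>L\<^sub>n < r\<close>, at \<open>k = 0\<close> it is the right-hand side. Truncated subtraction on the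
  natural numbers is harmless: for \<open>r > n\<close> both sides are 1.\<close>

theorem prob_card_returns_less:
  "prob {\<omega> \<in> space M. card (returns n \<omega>) < r} =
   prob {\<omega> \<in> space M. - int r \<le> walk X (n - r) \<omega> \<and> walk X (n - r) \<omega> < int r}"
proof (cases "r = 0")
  case False
  note [measurable] = measurable_walk measurable_returns
  define V where "V k = expectation (\<lambda>\<omega>. few_returns (n - k) (walk X k \<omega>) (r - card (returns k \<omega>)))" for k
  have step: "V (Suc k) = V k" if "k < n" for k
  proof -
    define n' where "n' = n - Suc k"
    have n': "n - k = Suc n'" using that by (simp add: n'_def)
    have int: "integrable M (\<lambda>\<omega>. few_returns n' (f \<omega>) (h \<omega>))"
      if [measurable]: "f \<in> measurable M (count_space UNIV)" "h \<in> measurable M (count_space UNIV)" for f h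
    proof (rule integrable_const_bound[where B=1])
      show "(\<lambda>\<omega>. few_returns n' (f \<omega>) (h \<omega>)) \<in> borel_measurable M"
      proof -
        have "(\<lambda>\<omega>. (f \<omega>, h \<omega>)) \<in> measurable M (count_space UNIV \<Otimes>\<^sub>M count_space UNIV)"
          by measurable
        then have "(\<lambda>\<omega>. (f \<omega>, h \<omega>)) \<in> measurable M (count_space UNIV)"
          by (simp add: pair_measure_countable)
        from measurable_compose[OF this, of "\<lambda>(s, r). few_returns n' s r" borel]
        show ?thesis by simp
      qed
    qed (auto simp: few_returns_bounds)
    have "V (Suc k) = (expectation (\<lambda>\<omega>. few_returns n' (walk X k \<omega> + 1) (r - (card (returns k \<omega>) + (if walk X k \<omega> = - 1 then 1 else 0)))) +
     expectation (\<lambda>\<omega>. few_returns n' (walk X k \<omega> - 1) (r - (card (returns k \<omega>) + (if walk X k \<omega> = 1 then 1 else 0))))) / 2"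
      unfolding V_def n'_def
      by (rule expectation_walk_step[where g="\<lambda>s l. few_returns (n - Suc k) s (r - l)" and B=1])
         (rule few_returns_bounds)
    also have "\<dots> = expectation (\<lambda>\<omega>. (few_returns n' (walk X k \<omega> + 1) (r - (card (returns k \<omega>) + (if walk X k \<omega> = - 1 then 1 else 0)))
      + few_returns n' (walk X k \<omega> - 1) (r - (card (returns k \<omega>) + (if walk X k \<omega> = 1 then 1 else 0)))) / 2)"
      by (subst Bochner_Integration.integral_add[symmetric], (rule int; measurable)+) simp
    also have "\<dots> = V k"
      unfolding V_def n' few_returns_Suc by (simp add: diff_diff_eq)
    finally show ?thesis .
  qed
  have const: "k \<le> n \<Longrightarrow> V k = V 0" for k
    by (induction k) (auto simp: step)
  have "V n = V 0" by (rule const) simp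
  moreover have "V n = prob {\<omega> \<in> space M. card (returns n \<omega>) < r}"
  proof -
    have "(\<lambda>\<omega>. if r - card (returns n \<omega>) = 0 then 0 else 1 :: real) = indicator {\<omega>. card (returns n \<omega>) < r}"
      by (auto simp: fun_eq_iff indicator_def)
    then show ?thesis by (simp add: V_def few_returns_start Int_def conj_commute del: diff_is_0_eq)
  qed
  moreover have "V 0 = near r (n - r)"
    using False by (simp add: V_def walk_def returns_def few_returns_def prob_space)
  ultimately show ?thesis by (simp add: near_def)
next
  case True
  then show ?thesis using near_0[of n] by (simp add: near_def)
qed

end

section \<open>Exponential and Gaussian laws\<close>

abbreviation exp_law :: "real measure" where
  "exp_law \<equiv> density lborel (\<lambda>x. ennreal (exponential_density 1 x))"

lemma prob_space_exp_law: "prob_space exp_law"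
  by (rule prob_space_exponential_density) simp

lemma measure_exp_law_greaterThan: "0 \<le> y \<Longrightarrow> measure exp_law {y<..} = exp (- y)"
proof -
  assume y: "0 \<le> y"
  interpret prob_space exp_law by (rule prob_space_exp_law)
  have "distributed exp_law lborel (\<lambda>x. x) (exponential_density 1)"
    by (auto simp: distributed_def distr_id2)
  from exponential_distributedD_gt[OF this y] show ?thesis
    by (simp add: greaterThan_def)
qed

text \<open>Both identities compute the probability of \<open>T < u\<close> for \<open>u\<close> of law \<open>A\<close> independent of \<open>T\<close>, one by
  integrating over \<open>u\<close> first and one over the product space.\<close>

lemma (in prob_space) integral_prob_less_fubini:
  fixes T :: "'a \<Rightarrow> real" and A :: "real measure"
  assumes [measurable]: "T \<in> borel_measurable M" and A: "prob_space A" and setsA [measurable_cong]: "sets A = sets borel"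
  shows "(\<integral>u. prob {\<omega> \<in> space M. T \<omega> < u} \<partial>A) = expectation (\<lambda>\<omega>. measure A {T \<omega><..})"
    and "(\<integral>u. prob {\<omega> \<in> space M. T \<omega> < u} \<partial>A) =
      measure (A \<Otimes>\<^sub>M M) {p \<in> space (A \<Otimes>\<^sub>M M). T (snd p) < fst p}"
proof -
  interpret A: prob_space A by (rule A)
  interpret AM: pair_prob_space A M ..
  define f where "f u \<omega> = (if T \<omega> < u then 1 else 0 :: real)" for u \<omega>
  have spA: "space A = UNIV"
    using sets_eq_imp_space_eq[OF setsA] by simp
  have [measurable]: "case_prod f \<in> borel_measurable (A \<Otimes>\<^sub>M M)"
    unfolding f_def by measurable
  have int: "integrable (A \<Otimes>\<^sub>M M) (case_prod f)"
    by (rule AM.integrable_const_bound[where B=1]) (auto simp: f_def)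
  have 1: "(\<integral>\<omega>. f u \<omega> \<partial>M) = prob {\<omega> \<in> space M. T \<omega> < u}" for u
  proof -
    have "f u = indicator {\<omega>. T \<omega> < u}" by (auto simp: f_def fun_eq_iff indicator_def)
    then show ?thesis by (simp add: Int_def conj_commute)
  qed
  have 2: "(\<integral>u. f u \<omega> \<partial>A) = measure A {T \<omega><..}" for \<omega>
  proof -
    have "(\<lambda>u. f u \<omega>) = indicator {T \<omega><..}" by (auto simp: f_def fun_eq_iff indicator_def)
    then show ?thesis by (simp add: spA)
  qed
  show "(\<integral>u. prob {\<omega> \<in> space M. T \<omega> < u} \<partial>A) = expectation (\<lambda>\<omega>. measure A {T \<omega><..})"
    using AM.Fubini_integral[OF int] unfolding 1 2 by simp
  have "case_prod f = indicator {p. T (snd p) < fst p}"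
    by (auto simp: f_def fun_eq_iff indicator_def)
  then have "integral\<^sup>L (A \<Otimes>\<^sub>M M) (case_prod f) = measure (A \<Otimes>\<^sub>M M) {p \<in> space (A \<Otimes>\<^sub>M M). T (snd p) < fst p}"
    by (simp add: Int_def conj_commute)
  then show "(\<integral>u. prob {\<omega> \<in> space M. T \<omega> < u} \<partial>A) =
      measure (A \<Otimes>\<^sub>M M) {p \<in> space (A \<Otimes>\<^sub>M M). T (snd p) < fst p}"
    using AM.integral_fst[OF int] unfolding 1 by simp
qed

text \<open>The number \<open>exp (- y)\<close> is the probability that a standard exponential variable exceeds \<open>y\<close>.\<close>

lemma (in prob_space) expectation_exp_eq_integral_prob:
  assumes [measurable]: "T \<in> borel_measurable M" and nonneg: "\<And>\<omega>. 0 \<le> T \<omega>"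
  shows "expectation (\<lambda>\<omega>. exp (- T \<omega>)) = (\<integral>u. prob {\<omega> \<in> space M. T \<omega> < u} \<partial>exp_law)"
  using integral_prob_less_fubini(1)[of T exp_law] prob_space_exp_law nonneg
  by (simp add: measure_exp_law_greaterThan)

lemma (in prob_space) prob_less_exponential:
  fixes E T :: "'a \<Rightarrow> real"
  assumes indep: "indep_var borel E borel T"
    and E: "distributed M lborel E (\<lambda>x. ennreal (exponential_density 1 x))"
  shows "prob {\<omega> \<in> space M. T \<omega> < E \<omega>} = (\<integral>u. prob {\<omega> \<in> space M. T \<omega> < u} \<partial>exp_law)"
proof -
  note [measurable] = indep_var_rv1[OF indep] indep_var_rv2[OF indep]
  interpret T: prob_space "distr M borel T" by (rule prob_space_distr) measurable
  have "distr M borel E = exp_law"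
    using distributed_distr_eq_density[OF E] by (simp cong: distr_cong)
  then have joint: "distr M (borel \<Otimes>\<^sub>M borel) (\<lambda>\<omega>. (E \<omega>, T \<omega>)) = exp_law \<Otimes>\<^sub>M distr M borel T"
    using indep by (simp add: indep_var_distribution_eq)
  have [measurable]: "{p \<in> space (borel \<Otimes>\<^sub>M borel). snd p < fst p} \<in> sets (borel \<Otimes>\<^sub>M (borel :: real measure))"
    by measurable
  have "prob {\<omega> \<in> space M. T \<omega> < E \<omega>} =
      measure (distr M (borel \<Otimes>\<^sub>M borel) (\<lambda>\<omega>. (E \<omega>, T \<omega>))) {p \<in> space (borel \<Otimes>\<^sub>M borel). snd p < fst p}"
    by (subst measure_distr) (measurable, auto simp: space_pair_measure intro!: arg_cong[where f=prob])
  also have "\<dots> = (\<integral>u. measure (distr M borel T) {x \<in> space (distr M borel T). x < u} \<partial>exp_law)"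
    unfolding joint
    by (subst T.integral_prob_less_fubini(2)) (auto simp: prob_space_exp_law space_pair_measure)
  also have "\<dots> = (\<integral>u. prob {\<omega> \<in> space M. T \<omega> < u} \<partial>exp_law)"
    by (subst measure_distr) (auto intro!: Bochner_Integration.integral_cong arg_cong[where f=prob])
  finally show ?thesis .
qed

abbreviation \<Phi> :: "real \<Rightarrow> real" where
  "\<Phi> \<equiv> cdf std_normal_distribution"

interpretation std_normal: real_distribution std_normal_distribution
  by (rule real_dist_normal_dist)

lemma std_normal_singleton: "measure std_normal_distribution {x} = 0"
proof -
  have "emeasure std_normal_distribution {x} = 0"
    by (subst emeasure_density) (auto simp: nn_integral_0_iff_AE intro!: AE_I[of _ _ "{x}"])
  then show ?thesis by (simp add: measure_def)
qed

lemma isCont_std_normal_cdf: "isCont \<Phi> x"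
  by (simp add: std_normal.isCont_cdf std_normal_singleton)

lemma borel_measurable_std_normal_cdf [measurable]: "\<Phi> \<in> borel_measurable borel"
  by (intro borel_measurable_continuous_onI continuous_at_imp_continuous_on) (simp add: isCont_std_normal_cdf)

lemma prob_abs_std_normal_less:
  assumes N: "prob_space P" "distributed P lborel N (\<lambda>x. ennreal (std_normal_density x))"
    and "0 \<le> x"
  shows "measure P {\<omega> \<in> space P. \<bar>N \<omega>\<bar> < x} = \<Phi> x - \<Phi> (- x)"
proof (cases "x = 0")
  case False
  interpret prob_space P by (rule N)
  have [measurable]: "N \<in> borel_measurable P" using N(2) by (auto simp: distributed_def)
  have d: "distr P borel N = std_normal_distribution"
    using distributed_distr_eq_density[OF N(2)] by (simp cong: distr_cong)
  have "{\<omega> \<in> space P. \<bar>N \<omega>\<bar> < x} = N -` {- x<..<x} \<inter> space P" by auto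
  then have "measure P {\<omega> \<in> space P. \<bar>N \<omega>\<bar> < x} = measure (distr P borel N) {- x<..<x}"
    by (simp add: measure_distr)
  also have "\<dots> = measure std_normal_distribution {- x<..x} - measure std_normal_distribution {x}"
  proof -
    have "{- x<..x} = {- x<..<x} \<union> {x}" using False assms(3) by auto
    moreover have "measure std_normal_distribution ({- x<..<x} \<union> {x}) =
        measure std_normal_distribution {- x<..<x} + measure std_normal_distribution {x}"
      by (rule std_normal.finite_measure_Union) auto
    ultimately show ?thesis unfolding d by simp
  qed
  also have "\<dots> = \<Phi> x - \<Phi> (- x)"
  proof -
    have "{..x} = {..- x} \<union> {- x<..x}" using assms(3) by auto
    moreover have "measure std_normal_distribution ({..- x} \<union> {- x<..x}) =
        measure std_normal_distribution {..- x} + measure std_normal_distribution {- x<..x}"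
      by (rule std_normal.finite_measure_Union) auto
    ultimately have "\<Phi> x = \<Phi> (- x) + measure std_normal_distribution {- x<..x}"
      unfolding cdf_def by simp
    then show ?thesis by (simp add: std_normal_singleton)
  qed
  finally show ?thesis .
next
  case True
  then have "{\<omega> \<in> space P. \<bar>N \<omega>\<bar> < x} = {}" by auto
  with True show ?thesis by simp
qed

text \<open>For \<open>x > 0\<close> the event \<open>E / |N| > x\<close> is, up to the null set \<open>N = 0\<close>, the event \<open>x |N| < E\<close>. For
  \<open>x \<le> 0\<close> the event is null because \<open>E > 0\<close> almost surely.\<close>

lemma prob_ratio_exponential_normal:
  assumes P: "prob_space P"
    and indep: "prob_space.indep_var P borel E borel N"
    and E: "distributed P lborel E (\<lambda>x. ennreal (exponential_density 1 x))"
    and N: "distributed P lborel N (\<lambda>x. ennreal (std_normal_density x))"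
  shows "x \<le> 0 \<Longrightarrow> measure P {\<omega> \<in> space P. E \<omega> / \<bar>N \<omega>\<bar> \<le> x} = 0"
    and "0 < x \<Longrightarrow> measure P {\<omega> \<in> space P. E \<omega> / \<bar>N \<omega>\<bar> \<le> x} =
      1 - (\<integral>u. \<Phi> (u / x) - \<Phi> (- (u / x)) \<partial>exp_law)"
proof -
  interpret prob_space P by (rule P)
  have [measurable]: "N \<in> borel_measurable P" "E \<in> borel_measurable P"
    using E N by (auto simp: distributed_def)
  have Epos: "AE \<omega> in P. 0 < E \<omega>"
  proof (subst prob_Collect_eq_1[symmetric])
    show "prob {\<omega> \<in> space P. 0 < E \<omega>} = 1"
      using exponential_distributedD_gt[OF E, of 0] by simp
  qed measurable
  have Nnz: "AE \<omega> in P. N \<omega> \<noteq> 0"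
  proof (subst prob_Collect_eq_1[symmetric])
    have d: "distr P borel N = std_normal_distribution"
      using distributed_distr_eq_density[OF N] by (simp cong: distr_cong)
    have "prob {\<omega> \<in> space P. N \<omega> = 0} = measure (distr P borel N) {0}"
      by (subst measure_distr) (auto intro!: arg_cong[where f=prob])
    also have "\<dots> = 0" by (simp add: d std_normal_singleton)
    finally show "prob {\<omega> \<in> space P. N \<omega> \<noteq> 0} = 1"
      using prob_neg[of "\<lambda>\<omega>. N \<omega> = 0"] by simp
  qed measurable
  have pos: "AE \<omega> in P. 0 < E \<omega> / \<bar>N \<omega>\<bar>"
    using Epos Nnz by eventually_elim simp
  show "measure P {\<omega> \<in> space P. E \<omega> / \<bar>N \<omega>\<bar> \<le> x} = 0" if "x \<le> 0"
  proof -
    have "AE \<omega> in P. \<not> E \<omega> / \<bar>N \<omega>\<bar> \<le> x"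
      using pos by eventually_elim (use that in linarith)
    then show ?thesis by (subst prob_eq_0) auto
  qed
  show "measure P {\<omega> \<in> space P. E \<omega> / \<bar>N \<omega>\<bar> \<le> x} = 1 - (\<integral>u. \<Phi> (u / x) - \<Phi> (- (u / x)) \<partial>exp_law)"
    if x: "0 < x"
  proof -
    have "measure P {\<omega> \<in> space P. E \<omega> / \<bar>N \<omega>\<bar> \<le> x} = prob {\<omega> \<in> space P. \<not> x * \<bar>N \<omega>\<bar> < E \<omega>}"
    proof (rule finite_measure_eq_AE)
      show "AE \<omega> in P. (\<omega> \<in> {\<omega> \<in> space P. E \<omega> / \<bar>N \<omega>\<bar> \<le> x}) = (\<omega> \<in> {\<omega> \<in> space P. \<not> x * \<bar>N \<omega>\<bar> < E \<omega>})"
        using Nnz by eventually_elim (auto simp: field_simps not_less)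
    qed measurable
    also have "\<dots> = 1 - prob {\<omega> \<in> space P. x * \<bar>N \<omega>\<bar> < E \<omega>}"
      by (rule prob_neg) measurable
    also have "prob {\<omega> \<in> space P. x * \<bar>N \<omega>\<bar> < E \<omega>} = (\<integral>u. prob {\<omega> \<in> space P. x * \<bar>N \<omega>\<bar> < u} \<partial>exp_law)"
    proof (rule prob_less_exponential[OF _ E])
      show "indep_var borel E borel (\<lambda>\<omega>. x * \<bar>N \<omega>\<bar>)"
        using indep_var_compose[OF indep, of "\<lambda>y. y" borel "\<lambda>y. x * \<bar>y\<bar>" borel] by (simp add: comp_def)
    qed
    also have "\<dots> = (\<integral>u. \<Phi> (u / x) - \<Phi> (- (u / x)) \<partial>exp_law)"
    proof (rule integral_cong_AE)
      show "AE u in exp_law. prob {\<omega> \<in> space P. x * \<bar>N \<omega>\<bar> < u} = \<Phi> (u / x) - \<Phi> (- (u / x))"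
      proof (subst AE_density)
        show "AE u in lborel. 0 < ennreal (exponential_density 1 u) \<longrightarrow>
            prob {\<omega> \<in> space P. x * \<bar>N \<omega>\<bar> < u} = \<Phi> (u / x) - \<Phi> (- (u / x))"
        proof (intro AE_I2 impI)
          fix u assume "0 < ennreal (exponential_density 1 u)"
          then have "0 \<le> u" by (auto simp: exponential_density_def split: if_splits)
          then have "prob {\<omega> \<in> space P. \<bar>N \<omega>\<bar> < u / x} = \<Phi> (u / x) - \<Phi> (- (u / x))"
            using x by (intro prob_abs_std_normal_less[OF P N]) simp
          moreover have "x * \<bar>N \<omega>\<bar> < u \<longleftrightarrow> \<bar>N \<omega>\<bar> < u / x" for \<omega>
            using x by (simp add: field_simps)
          ultimately show "prob {\<omega> \<in> space P. x * \<bar>N \<omega>\<bar> < u} = \<Phi> (u / x) - \<Phi> (- (u / x))"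
            by simp
        qed
      qed measurable
    qed measurable
    finally show ?thesis .
  qed
qed

section \<open>The number of returns in the scaling limit\<close>

context simple_random_walk
begin

text \<open>Almost surely only the two values \<open>h 1\<close> and \<open>h (- 1)\<close> occur, so that unbounded \<open>h\<close> are covered;
  this yields the mean and the variance of a step.\<close>

lemma expectation_step:
  fixes h :: "int \<Rightarrow> real"
  shows "integrable M (\<lambda>\<omega>. h (X (Suc k) \<omega>))"
    and "expectation (\<lambda>\<omega>. h (X (Suc k) \<omega>)) = (h 1 + h (- 1)) / 2"
proof -
  define h' where "h' s = (if s = 1 \<or> s = - 1 then h s else 0)" for s
  have bd: "\<bar>h' s\<bar> \<le> \<bar>h 1\<bar> + \<bar>h (- 1)\<bar>" for s by (auto simp: h'_def)
  have meas [measurable]: "(\<lambda>\<omega>. g (X (Suc k) \<omega>)) \<in> borel_measurable M" for g :: "int \<Rightarrow> real"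
    by (rule measurable_compose[OF measurable_step]) auto
  have ae: "AE \<omega> in M. h (X (Suc k) \<omega>) = h' (X (Suc k) \<omega>)"
    using AE_step[of "Suc k"] by (auto simp: h'_def elim!: eventually_mono)
  have "integrable M (\<lambda>\<omega>. h' (X (Suc k) \<omega>))"
    by (rule integrable_const_bound[where B="\<bar>h 1\<bar> + \<bar>h (- 1)\<bar>"]) (auto simp: bd)
  then show "integrable M (\<lambda>\<omega>. h (X (Suc k) \<omega>))"
    using ae by (subst integrable_cong_AE) auto
  have "expectation (\<lambda>\<omega>. h (X (Suc k) \<omega>)) = expectation (\<lambda>\<omega>. h' (X (Suc k) \<omega>))"
    using ae by (intro integral_cong_AE) auto
  also have "\<dots> = (expectation (\<lambda>\<omega>. h' 1) + expectation (\<lambda>\<omega>. h' (- 1))) / 2"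
    by (rule expectation_one_step[where h="\<lambda>p. h'", OF bd refl])
  finally show "expectation (\<lambda>\<omega>. h (X (Suc k) \<omega>)) = (h 1 + h (- 1)) / 2"
    by (simp add: h'_def prob_space)
qed

lemma walk_central_limit:
  "(\<lambda>n. prob {\<omega> \<in> space M. real_of_int (walk X n \<omega>) / sqrt n \<le> x}) \<longlonglongrightarrow> \<Phi> x"
proof -
  define Z where "Z n \<omega> = real_of_int (X (Suc n) \<omega>)" for n \<omega>
  have [measurable]: "Z n \<in> borel_measurable M" for n
    unfolding Z_def by (rule measurable_compose[OF measurable_step]) auto
  have "indep_vars (\<lambda>j. PiM {Suc j} (\<lambda>_. count_space UNIV)) (\<lambda>j \<omega>. restrict (\<lambda>i. X i \<omega>) {Suc j}) UNIV"
    by (rule indep_vars_restrict[OF indep_steps]) (auto simp: disjoint_family_on_def)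
  then have "indep_vars (\<lambda>_. borel) (\<lambda>j \<omega>. real_of_int (restrict (\<lambda>i. X i \<omega>) {Suc j} (Suc j))) UNIV"
    by (rule indep_vars_compose2[where Y="\<lambda>j p. real_of_int (p (Suc j))"])
       (auto intro: measurable_compose[OF measurable_component_singleton])
  then have ind: "indep_vars (\<lambda>_. borel) Z UNIV"
    by (simp add: Z_def[abs_def])
  have mean: "expectation (Z n) = 0" for n
    using expectation_step(2)[of real_of_int n] by (simp add: Z_def[abs_def])
  have sq: "integrable M (\<lambda>\<omega>. (Z n \<omega>)\<^sup>2)" "expectation (\<lambda>\<omega>. (Z n \<omega>)\<^sup>2) = 1" for n
    using expectation_step[of "\<lambda>s. (real_of_int s)\<^sup>2" n] by (simp_all add: Z_def[abs_def])
  have distr: "distr M borel (Z n) = distr M borel (Z 0)" for n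
  proof (rule measure_eqI)
    fix A assume "A \<in> sets (distr M borel (Z n))"
    then have [measurable]: "A \<in> sets borel" by simp
    have half: "measure (distr M borel (Z k)) A = (indicator A 1 + indicator A (- 1)) / 2" for k
    proof -
      have "measure (distr M borel (Z k)) A = (\<integral>z. indicator A z \<partial>distr M borel (Z k))"
        by simp
      also have "\<dots> = expectation (\<lambda>\<omega>. indicator A (Z k \<omega>))"
        by (rule integral_distr) auto
      finally have "measure (distr M borel (Z k)) A = expectation (\<lambda>\<omega>. indicator A (Z k \<omega>))" .
      then show ?thesis
        using expectation_step(2)[of "\<lambda>s. indicator A (real_of_int s)" k] by (simp add: Z_def[abs_def])
    qed
    have "emeasure (distr M borel (Z k)) A = ennreal ((indicator A 1 + indicator A (- 1)) / 2)" for k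
      by (subst finite_measure.emeasure_eq_measure[OF finite_measure_distr]) (measurable, simp add: half)
    then show "emeasure (distr M borel (Z n)) A = emeasure (distr M borel (Z 0)) A"
      by simp
  qed simp
  have "weak_conv_m (\<lambda>n. distr M borel (\<lambda>\<omega>. (\<Sum>i<n. Z i \<omega>) / sqrt (real n * 1\<^sup>2))) std_normal_distribution"
    by (rule central_limit_theorem_zero_mean[where X=Z and \<sigma>=1 and \<mu>="distr M borel (Z 0)"])
       (auto simp: ind mean sq intro: distr)
  then have "(\<lambda>n. cdf (distr M borel (\<lambda>\<omega>. (\<Sum>i<n. Z i \<omega>) / sqrt n)) x) \<longlonglongrightarrow> \<Phi> x"
    by (simp add: weak_conv_m_def weak_conv_def isCont_std_normal_cdf)
  moreover have "(\<Sum>i<n. Z i \<omega>) = real_of_int (walk X n \<omega>)" for n \<omega>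
    by (simp add: Z_def walk_def sum.atLeast1_atMost_eq)
  moreover have "cdf (distr M borel (\<lambda>\<omega>. (\<Sum>i<n. Z i \<omega>) / sqrt n)) x = prob {\<omega> \<in> space M. (\<Sum>i<n. Z i \<omega>) / sqrt n \<le> x}" for n
    unfolding cdf_def by (subst measure_distr) (auto intro!: arg_cong[where f=prob])
  ultimately show ?thesis by simp
qed

text \<open>The central limit theorem gives convergence at fixed thresholds. As distribution functions are
  monotone and the Gaussian one is continuous, thresholds that converge are allowed as well.\<close>

lemma prob_walk_less_tendsto:
  fixes m :: "nat \<Rightarrow> nat" and r :: "nat \<Rightarrow> int"
  assumes m: "filterlim m at_top sequentially"
    and r: "(\<lambda>i. real_of_int (r i) / sqrt (m i)) \<longlonglongrightarrow> x"
  shows "(\<lambda>i. prob {\<omega> \<in> space M. walk X (m i) \<omega> < r i}) \<longlonglongrightarrow> \<Phi> x"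
proof -
  note [measurable] = measurable_walk
  have [measurable]: "(\<lambda>\<omega>. real_of_int (walk X n \<omega>)) \<in> borel_measurable M" for n
    by (rule measurable_compose[OF measurable_walk]) auto
  have lim: "(\<lambda>i. prob {\<omega> \<in> space M. real_of_int (walk X (m i) \<omega>) / sqrt (m i) \<le> y}) \<longlonglongrightarrow> \<Phi> y" for y
    using filterlim_compose[OF walk_central_limit m] .
  have pos: "\<forall>\<^sub>F i in sequentially. 0 < m i"
    using m unfolding filterlim_at_top by (auto dest!: spec[of _ 1] elim!: eventually_mono)
  have cont: "(\<Phi> \<longlongrightarrow> \<Phi> x) (at_left x)" "(\<Phi> \<longlongrightarrow> \<Phi> x) (at_right x)"
    using isCont_std_normal_cdf[of x] by (simp_all add: isCont_def filterlim_at_split)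
  show ?thesis
  proof (rule order_tendstoI)
    fix a assume a: "a < \<Phi> x"
    have "\<forall>\<^sub>F y in at_left x. a < \<Phi> y \<and> y < x"
      using order_tendstoD(1)[OF cont(1) a] by (intro eventually_conj) (auto simp: eventually_at_filter)
    then obtain y where y: "a < \<Phi> y" "y < x"
      using eventually_happens[of _ "at_left x"] by auto
    show "\<forall>\<^sub>F i in sequentially. a < prob {\<omega> \<in> space M. walk X (m i) \<omega> < r i}"
      using order_tendstoD(1)[OF lim y(1)] order_tendstoD(1)[OF r y(2)] pos
    proof eventually_elim
      case (elim i)
      have "prob {\<omega> \<in> space M. real_of_int (walk X (m i) \<omega>) / sqrt (m i) \<le> y} \<le> prob {\<omega> \<in> space M. walk X (m i) \<omega> < r i}"
      proof (rule finite_measure_mono)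
        show "{\<omega> \<in> space M. real_of_int (walk X (m i) \<omega>) / sqrt (m i) \<le> y} \<subseteq> {\<omega> \<in> space M. walk X (m i) \<omega> < r i}"
        proof (intro Collect_mono impI conjI)
          fix \<omega> assume "\<omega> \<in> space M \<and> real_of_int (walk X (m i) \<omega>) / sqrt (m i) \<le> y"
          then have "real_of_int (walk X (m i) \<omega>) / sqrt (m i) < r i / sqrt (m i)" using elim by simp
          then show "walk X (m i) \<omega> < r i" using elim by (simp add: divide_less_cancel)
        qed simp
      qed measurable
      then show ?case using elim by simp
    qed
  next
    fix a assume a: "\<Phi> x < a"
    have "\<forall>\<^sub>F y in at_right x. \<Phi> y < a \<and> x < y"
      using order_tendstoD(2)[OF cont(2) a] by (intro eventually_conj) (auto simp: eventually_at_filter)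
    then obtain y where y: "\<Phi> y < a" "x < y"
      using eventually_happens[of _ "at_right x"] by auto
    show "\<forall>\<^sub>F i in sequentially. prob {\<omega> \<in> space M. walk X (m i) \<omega> < r i} < a"
      using order_tendstoD(2)[OF lim y(1)] order_tendstoD(2)[OF r y(2)] pos
    proof eventually_elim
      case (elim i)
      have "prob {\<omega> \<in> space M. walk X (m i) \<omega> < r i} \<le> prob {\<omega> \<in> space M. real_of_int (walk X (m i) \<omega>) / sqrt (m i) \<le> y}"
      proof (rule finite_measure_mono)
        show "{\<omega> \<in> space M. walk X (m i) \<omega> < r i} \<subseteq> {\<omega> \<in> space M. real_of_int (walk X (m i) \<omega>) / sqrt (m i) \<le> y}"
        proof (intro Collect_mono impI conjI)
          fix \<omega> assume "\<omega> \<in> space M \<and> walk X (m i) \<omega> < r i"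
          then have "real_of_int (walk X (m i) \<omega>) / sqrt (m i) \<le> r i / sqrt (m i)"
            by (intro divide_right_mono) auto
          then show "real_of_int (walk X (m i) \<omega>) / sqrt (m i) \<le> y" using elim by simp
        qed simp
      qed measurable
      then show ?case using elim by simp
    qed
  qed
qed

text \<open>This says that \<open>L\<^sub>n / \<surd>n\<close> converges in law to \<open>|N|\<close>. The time shift by \<open>r\<close> in the identity for
  \<open>P(L\<^sub>n < r)\<close> is invisible in the limit because \<open>r\<close> is of order \<open>\<surd>n\<close>.\<close>

lemma prob_card_returns_less_tendsto:
  fixes n r :: "nat \<Rightarrow> nat"
  assumes n: "filterlim n at_top sequentially"
    and r: "(\<lambda>i. r i / sqrt (n i)) \<longlonglongrightarrow> x"
  shows "(\<lambda>i. prob {\<omega> \<in> space M. card (returns (n i) \<omega>) < r i}) \<longlonglongrightarrow> \<Phi> x - \<Phi> (- x)"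
proof -
  note [measurable] = measurable_walk
  define m where "m i = n i - r i" for i
  have n_real: "filterlim (\<lambda>i. real (n i)) at_top sequentially"
    using filterlim_compose[OF filterlim_real_sequentially n] .
  have "(\<lambda>i. inverse (sqrt (n i))) \<longlonglongrightarrow> 0"
    by (rule tendsto_inverse_0_at_top[OF filterlim_compose[OF sqrt_at_top n_real]])
  from tendsto_mult[OF r this] have "(\<lambda>i. r i / sqrt (n i) * inverse (sqrt (n i))) \<longlonglongrightarrow> 0" by simp
  then have ratio: "(\<lambda>i. r i / n i) \<longlonglongrightarrow> 0"
    by (simp add: divide_inverse mult.assoc flip: inverse_mult_distrib)
  have npos: "\<forall>\<^sub>F i in sequentially. 0 < n i"
    using n unfolding filterlim_at_top by (auto dest!: spec[of _ 1] elim!: eventually_mono)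
  have small: "\<forall>\<^sub>F i in sequentially. r i / n i < 1 / 2"
    by (rule order_tendstoD(2)[OF ratio]) simp
  have m_eq: "\<forall>\<^sub>F i in sequentially. real (m i) = real (n i) * (1 - r i / n i) \<and> n i \<le> 2 * m i"
    using npos small
  proof eventually_elim
    case (elim i)
    then have "2 * r i < n i" by (simp add: field_simps)
    then show ?case using elim by (simp add: m_def field_simps of_nat_diff)
  qed
  have m: "filterlim m at_top sequentially"
    unfolding filterlim_at_top
  proof
    fix Z
    have "\<forall>\<^sub>F i in sequentially. 2 * Z \<le> n i" using n by (simp add: filterlim_at_top)
    with m_eq show "\<forall>\<^sub>F i in sequentially. Z \<le> m i" by eventually_elim simp
  qed
  have "(\<lambda>i. r i / sqrt (n i) / sqrt (1 - r i / n i)) \<longlonglongrightarrow> x / sqrt (1 - 0)"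
    by (intro tendsto_intros r ratio) simp
  then have "(\<lambda>i. r i / sqrt (m i)) \<longlonglongrightarrow> x / sqrt (1 - 0)"
  proof (rule Lim_transform_eventually)
    show "\<forall>\<^sub>F i in sequentially. r i / sqrt (n i) / sqrt (1 - r i / n i) = r i / sqrt (m i)"
      using m_eq by eventually_elim (simp add: real_sqrt_mult)
  qed
  then have rm: "(\<lambda>i. r i / sqrt (m i)) \<longlonglongrightarrow> x" by simp
  have "(\<lambda>i. prob {\<omega> \<in> space M. walk X (m i) \<omega> < int (r i)}) \<longlonglongrightarrow> \<Phi> x"
    using rm by (intro prob_walk_less_tendsto m) simp
  moreover have "(\<lambda>i. prob {\<omega> \<in> space M. walk X (m i) \<omega> < - int (r i)}) \<longlonglongrightarrow> \<Phi> (- x)"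
    using tendsto_minus[OF rm] by (intro prob_walk_less_tendsto m) simp
  moreover have "prob {\<omega> \<in> space M. card (returns (n i) \<omega>) < r i} =
      prob {\<omega> \<in> space M. walk X (m i) \<omega> < int (r i)} - prob {\<omega> \<in> space M. walk X (m i) \<omega> < - int (r i)}" for i
  proof -
    define A where "A = {\<omega> \<in> space M. walk X (m i) \<omega> < - int (r i)}"
    define B where "B = {\<omega> \<in> space M. - int (r i) \<le> walk X (m i) \<omega> \<and> walk X (m i) \<omega> < int (r i)}"
    have AB: "{\<omega> \<in> space M. walk X (m i) \<omega> < int (r i)} = A \<union> B"
      by (auto simp: A_def B_def)
    have "prob (A \<union> B) = prob A + prob B"
      by (rule finite_measure_Union) (auto simp: A_def B_def)
    moreover have "prob {\<omega> \<in> space M. card (returns (n i) \<omega>) < r i} = prob B"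
      unfolding B_def m_def by (rule prob_card_returns_less)
    ultimately show ?thesis unfolding AB A_def[symmetric] by linarith
  qed
  ultimately show ?thesis by (simp add: tendsto_diff)
qed

text \<open>Writing \<open>1 - a = exp (- b)\<close>, the expectation is the integral of \<open>P(b L\<^sub>n < u)\<close> against the
  exponential law, and \<open>b \<surd>n \<rightarrow> t\<close> as well since \<open>b / a \<rightarrow> 1\<close>. Each integrand converges, and
  all are bounded by 1.\<close>

lemma expectation_power_card_returns_tendsto:
  fixes n :: "nat \<Rightarrow> nat" and a :: "nat \<Rightarrow> real"
  assumes n: "filterlim n at_top sequentially"
    and a: "\<And>i. 0 < a i" "\<And>i. a i < 1" "a \<longlonglongrightarrow> 0"
    and t: "0 < t" "(\<lambda>i. a i * sqrt (n i)) \<longlonglongrightarrow> t"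
  shows "(\<lambda>i. expectation (\<lambda>\<omega>. (1 - a i) ^ card (returns (n i) \<omega>))) \<longlonglongrightarrow>
    (\<integral>u. \<Phi> (u / t) - \<Phi> (- (u / t)) \<partial>exp_law)"
proof -
  note [measurable] = measurable_returns
  interpret exp_law: prob_space exp_law by (rule prob_space_exp_law)
  define b where "b i = - ln (1 - a i)" for i
  have b: "0 < b i" "exp (- b i) = 1 - a i" for i
    using a(1,2)[of i] by (auto simp: b_def)
  \<comment> \<open>A difference quotient at 0.\<close>
  have "((\<lambda>y. - ln (1 - y) / y) \<longlongrightarrow> 1) (at (0::real))"
  proof -
    have "((\<lambda>y. - ln (1 - y)) has_field_derivative 1) (at (0::real))"
      by (auto intro!: derivative_eq_intros)
    then show ?thesis by (simp add: has_field_derivative_iff)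
  qed
  moreover have "filterlim a (at 0) sequentially"
    using a(1,3) by (auto simp: filterlim_at intro!: always_eventually) (metis less_irrefl)
  ultimately have "(\<lambda>i. b i / a i) \<longlonglongrightarrow> 1"
    unfolding b_def by (rule filterlim_compose)
  from tendsto_mult[OF this t(2)] have bt: "(\<lambda>i. b i * sqrt (n i)) \<longlonglongrightarrow> t"
    using a(1) by (simp add: less_imp_neq[THEN not_sym])
  have n_real: "filterlim (\<lambda>i. real (n i)) at_top sequentially"
    using filterlim_compose[OF filterlim_real_sequentially n] .
  have sqrt0: "(\<lambda>i. 1 / sqrt (n i)) \<longlonglongrightarrow> 0"
    using tendsto_inverse_0_at_top[OF filterlim_compose[OF sqrt_at_top n_real]] by (simp add: inverse_eq_divide)
  have pw: "(\<lambda>i. prob {\<omega> \<in> space M. b i * card (returns (n i) \<omega>) < u}) \<longlonglongrightarrow> \<Phi> (u / t) - \<Phi> (- (u / t))"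
    if u: "0 \<le> u" for u
  proof -
    \<comment> \<open>Chosen so that \<open>L < r i\<close> is the same as \<open>b i * L < u\<close> for integer \<open>L\<close>.\<close>
    define r where "r i = nat \<lceil>u / b i\<rceil>" for i
    have lo: "u / (b i * sqrt (n i)) \<le> r i / sqrt (n i)" for i
    proof -
      have "u / b i \<le> r i" unfolding r_def by linarith
      then have "u / b i / sqrt (n i) \<le> r i / sqrt (n i)" by (rule divide_right_mono) simp
      then show ?thesis by simp
    qed
    have hi: "r i / sqrt (n i) \<le> u / (b i * sqrt (n i)) + 1 / sqrt (n i)" for i
    proof -
      have "0 \<le> u / b i" using u b(1)[of i] by simp
      then have "r i \<le> u / b i + 1" unfolding r_def by linarith
      then have "r i / sqrt (n i) \<le> (u / b i + 1) / sqrt (n i)" by (rule divide_right_mono) simp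
      then show ?thesis by (simp add: add_divide_distrib)
    qed
    have l1: "(\<lambda>i. u / (b i * sqrt (n i))) \<longlonglongrightarrow> u / t"
      using t(1) by (intro tendsto_intros bt) simp
    then have l2: "(\<lambda>i. u / (b i * sqrt (n i)) + 1 / sqrt (n i)) \<longlonglongrightarrow> u / t"
      using tendsto_add[OF l1 sqrt0] by simp
    have "(\<lambda>i. r i / sqrt (n i)) \<longlonglongrightarrow> u / t"
      by (rule tendsto_sandwich[OF _ _ l1 l2]) (auto intro: always_eventually lo hi)
    from prob_card_returns_less_tendsto[OF n this]
    have "(\<lambda>i. prob {\<omega> \<in> space M. card (returns (n i) \<omega>) < r i}) \<longlonglongrightarrow> \<Phi> (u / t) - \<Phi> (- (u / t))" .
    moreover have "card (returns (n i) \<omega>) < r i \<longleftrightarrow> b i * card (returns (n i) \<omega>) < u" for i \<omega>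
    proof -
      have "card (returns (n i) \<omega>) < r i \<longleftrightarrow> real (card (returns (n i) \<omega>)) < u / b i"
        unfolding r_def by linarith
      then show ?thesis using b(1)[of i] by (simp add: field_simps)
    qed
    ultimately show ?thesis by simp
  qed
  have eq: "expectation (\<lambda>\<omega>. (1 - a i) ^ card (returns (n i) \<omega>)) =
      (\<integral>u. prob {\<omega> \<in> space M. b i * card (returns (n i) \<omega>) < u} \<partial>exp_law)" for i
  proof -
    have "(1 - a i) ^ card (returns (n i) \<omega>) = exp (- (b i * card (returns (n i) \<omega>)))" for \<omega>
      by (simp add: b(2)[symmetric] exp_of_nat_mult[symmetric] mult.commute)
    then show ?thesis
      using b(1)[of i] by (simp add: expectation_exp_eq_integral_prob)
  qed
  show ?thesis
    unfolding eq
  proof (rule integral_dominated_convergence[where w="\<lambda>_. 1"])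
    show "(\<lambda>u. prob {\<omega> \<in> space M. b i * card (returns (n i) \<omega>) < u}) \<in> borel_measurable exp_law" for i
      by measurable
    show "AE u in exp_law. (\<lambda>i. prob {\<omega> \<in> space M. b i * card (returns (n i) \<omega>) < u}) \<longlonglongrightarrow> \<Phi> (u / t) - \<Phi> (- (u / t))"
    proof (subst AE_density)
      show "AE u in lborel. 0 < ennreal (exponential_density 1 u) \<longrightarrow>
          (\<lambda>i. prob {\<omega> \<in> space M. b i * card (returns (n i) \<omega>) < u}) \<longlonglongrightarrow> \<Phi> (u / t) - \<Phi> (- (u / t))"
        using pw by (auto simp: exponential_density_def)
    qed measurable
  qed auto
qed

end

section \<open>Arbitrary norms on Euclidean space\<close>

lemma is_normD:
  assumes "is_norm \<nu>"
  shows "\<nu> x = 0 \<longleftrightarrow> x = 0" "\<nu> (a *\<^sub>R x) = \<bar>a\<bar> * \<nu> x" "\<nu> (x + y) \<le> \<nu> x + \<nu> y"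
  using assms by (auto simp: is_norm_def)

lemma is_norm_minus: "is_norm \<nu> \<Longrightarrow> \<nu> (- x) = \<nu> x"
  using is_normD(2)[of \<nu> "- 1" x] by simp

lemma is_norm_nonneg:
  assumes "is_norm \<nu>"
  shows "0 \<le> \<nu> x"
  using is_normD(3)[OF assms, of x "- x"] is_normD(1)[OF assms, of 0] is_norm_minus[OF assms, of x] by simp

lemma is_norm_le_norm:
  fixes \<nu> :: "'v::euclidean_space \<Rightarrow> real"
  assumes \<nu>: "is_norm \<nu>"
  obtains C where "0 < C" "\<And>x. \<nu> x \<le> C * norm x"
proof
  have sum: "\<nu> (\<Sum>b\<in>A. f b) \<le> (\<Sum>b\<in>A. \<nu> (f b))" if "finite A" for A and f :: "'v \<Rightarrow> 'v"
    using that
  proof (induction A rule: finite_induct)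
    case empty
    then show ?case using is_normD(1)[OF \<nu>, of 0] by simp
  next
    case (insert b A)
    then show ?case using is_normD(3)[OF \<nu>, of "f b" "sum f A"] by simp
  qed
  show "0 < 1 + (\<Sum>b\<in>Basis. \<nu> b)"
    using sum_nonneg[of Basis \<nu>] is_norm_nonneg[OF \<nu>] by simp
  show "\<nu> x \<le> (1 + (\<Sum>b\<in>Basis. \<nu> b)) * norm x" for x
  proof -
    have "\<nu> x = \<nu> (\<Sum>b\<in>Basis. (x \<bullet> b) *\<^sub>R b)" by (simp add: euclidean_representation)
    also have "\<dots> \<le> (\<Sum>b\<in>Basis. \<bar>x \<bullet> b\<bar> * \<nu> b)"
      using sum[of Basis "\<lambda>b. (x \<bullet> b) *\<^sub>R b"] by (simp add: is_normD(2)[OF \<nu>])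
    also have "\<dots> \<le> (\<Sum>b\<in>Basis. norm x * \<nu> b)"
      by (intro sum_mono mult_right_mono Basis_le_norm is_norm_nonneg \<nu>)
    also have "\<dots> \<le> (1 + (\<Sum>b\<in>Basis. \<nu> b)) * norm x"
      by (simp add: algebra_simps sum_distrib_left)
    finally show ?thesis .
  qed
qed

lemma is_norm_continuous:
  fixes \<nu> :: "'v::euclidean_space \<Rightarrow> real"
  assumes \<nu>: "is_norm \<nu>"
  shows "continuous_on A \<nu>"
proof -
  obtain C where C: "0 < C" "\<And>x. \<nu> x \<le> C * norm x" using is_norm_le_norm[OF \<nu>] by blast
  have "\<bar>\<nu> x - \<nu> y\<bar> \<le> C * dist x y" for x y
  proof -
    have "\<nu> x \<le> \<nu> (x - y) + \<nu> y" "\<nu> y \<le> \<nu> (y - x) + \<nu> x"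
      using is_normD(3)[OF \<nu>, of "x - y" y] is_normD(3)[OF \<nu>, of "y - x" x] by auto
    moreover have "\<nu> (y - x) = \<nu> (x - y)" using is_norm_minus[OF \<nu>, of "x - y"] by simp
    ultimately show ?thesis using C(2)[of "x - y"] by (simp add: dist_norm)
  qed
  then have "C-lipschitz_on A \<nu>"
    using C(1) by (intro lipschitz_onI) (auto simp: dist_real_def)
  then show ?thesis by (rule lipschitz_on_continuous_on)
qed

lemma borel_measurable_is_norm: "is_norm \<nu> \<Longrightarrow> \<nu> \<in> borel_measurable borel"
  for \<nu> :: "'v::euclidean_space \<Rightarrow> real"
  by (intro borel_measurable_continuous_onI is_norm_continuous)

text \<open>A norm attains a positive minimum on the Euclidean unit sphere.\<close>

lemma norm_le_is_norm:
  fixes \<nu> :: "'v::euclidean_space \<Rightarrow> real"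
  assumes \<nu>: "is_norm \<nu>"
  obtains K where "0 < K" "\<And>x. norm x \<le> K * \<nu> x"
proof -
  have "sphere (0::'v) 1 \<noteq> {}" by simp
  then obtain z where z: "norm z = 1" "\<And>y. norm y = 1 \<Longrightarrow> \<nu> z \<le> \<nu> y"
    using continuous_attains_inf[OF compact_sphere _ is_norm_continuous[OF \<nu>], of 0 1] by auto
  have pos: "0 < \<nu> z"
    using is_norm_nonneg[OF \<nu>, of z] is_normD(1)[OF \<nu>, of z] z(1) by (metis less_eq_real_def norm_zero zero_neq_one)
  show ?thesis
  proof
    show "0 < 1 / \<nu> z" using pos by simp
    show "norm x \<le> 1 / \<nu> z * \<nu> x" for x
    proof (cases "x = 0")
      case False
      then have "\<nu> z \<le> \<nu> (inverse (norm x) *\<^sub>R x)" by (intro z(2)) simp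
      then show ?thesis using False pos by (simp add: is_normD(2)[OF \<nu>] field_simps)
    qed (simp add: is_norm_nonneg[OF \<nu>])
  qed
qed

lemma norm_ball_borel:
  fixes \<nu> :: "'v::euclidean_space \<Rightarrow> real"
  assumes "is_norm \<nu>"
  shows "norm_ball \<nu> x \<epsilon> \<in> sets borel"
proof -
  note [measurable] = borel_measurable_is_norm[OF assms]
  show ?thesis unfolding norm_ball_def by measurable
qed

lemma measure_norm_ball:
  fixes \<nu> :: "'v::euclidean_space \<Rightarrow> real"
  assumes \<nu>: "is_norm \<nu>" and "0 < \<epsilon>"
  shows "measure lborel (norm_ball \<nu> x \<epsilon>) = measure lborel (norm_ball \<nu> 0 1) * \<epsilon> ^ DIM('v)"
proof -
  have "norm_ball \<nu> x \<epsilon> = (\<lambda>y. \<epsilon> *\<^sub>R y + x) ` norm_ball \<nu> 0 1"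
  proof (intro set_eqI iffI)
    fix y assume "y \<in> norm_ball \<nu> x \<epsilon>"
    then have "inverse \<epsilon> * \<nu> (y - x) < 1"
      using assms(2) by (simp add: norm_ball_def field_simps)
    then have "inverse \<epsilon> *\<^sub>R (y - x) \<in> norm_ball \<nu> 0 1"
      using assms(2) by (simp add: norm_ball_def is_normD(2)[OF \<nu>])
    moreover have "y = \<epsilon> *\<^sub>R (inverse \<epsilon> *\<^sub>R (y - x)) + x" using assms(2) by simp
    ultimately show "y \<in> (\<lambda>y. \<epsilon> *\<^sub>R y + x) ` norm_ball \<nu> 0 1" by (metis imageI)
  next
    fix y assume "y \<in> (\<lambda>y. \<epsilon> *\<^sub>R y + x) ` norm_ball \<nu> 0 1"
    then show "y \<in> norm_ball \<nu> x \<epsilon>"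
      using assms(2) by (auto simp: norm_ball_def is_normD(2)[OF \<nu>])
  qed
  then have "measure lebesgue (norm_ball \<nu> x \<epsilon>) = \<epsilon> ^ DIM('v) * measure lebesgue (norm_ball \<nu> 0 1)"
    using measure_lebesgue_affine[of \<epsilon> x "norm_ball \<nu> 0 1"] assms(2) by simp
  then show ?thesis
    using norm_ball_borel[OF \<nu>] by (simp add: mult.commute)
qed

lemma measure_norm_ball_pos:
  fixes \<nu> :: "'v::euclidean_space \<Rightarrow> real"
  assumes \<nu>: "is_norm \<nu>"
  shows "0 < measure lborel (norm_ball \<nu> (0::'v) 1)"
proof -
  obtain C where C: "0 < C" "\<And>x. \<nu> x \<le> C * norm x" using is_norm_le_norm[OF \<nu>] by blast
  obtain K where K: "0 < K" "\<And>x. norm x \<le> K * \<nu> x" using norm_le_is_norm[OF \<nu>] by blast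
  have sub: "ball 0 (1 / C) \<subseteq> norm_ball \<nu> 0 1"
  proof
    fix x :: 'v assume "x \<in> ball 0 (1 / C)"
    then have "C * norm x < 1" using C(1) by (simp add: field_simps)
    then show "x \<in> norm_ball \<nu> 0 1" using C(2)[of x] by (simp add: norm_ball_def)
  qed
  have "norm_ball \<nu> 0 1 \<subseteq> ball 0 K"
  proof
    fix x :: 'v assume "x \<in> norm_ball \<nu> 0 1"
    then have "K * \<nu> x < K * 1" using K(1) by (intro mult_strict_left_mono) (auto simp: norm_ball_def)
    then show "x \<in> ball 0 K" using K(2)[of x] by simp
  qed
  then have "bounded (norm_ball \<nu> 0 1)" using bounded_ball bounded_subset by blast
  then have "norm_ball \<nu> 0 1 \<in> fmeasurable lborel"
    using norm_ball_borel[OF \<nu>] emeasure_bounded_finite by (intro fmeasurableI) (auto simp: less_top)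
  then have "measure lborel (ball (0::'v) (1 / C)) \<le> measure lborel (norm_ball \<nu> 0 1)"
    by (intro measure_mono_fmeasurable sub) auto
  moreover have "0 < measure lborel (ball (0::'v) (1 / C))" using C(1) by (intro content_ball_pos) simp
  ultimately show ?thesis by linarith
qed

section \<open>The process in the strip\<close>

definition inner_cube :: "real \<Rightarrow> (real^'n) set" where
  "inner_cube \<delta> = {y. \<forall>i. \<delta> < y $ i \<and> y $ i < 1 - \<delta>}"

lemma inner_cube_box: "inner_cube \<delta> = box (\<chi> i. \<delta>) (\<chi> i. 1 - \<delta>)"
  by (auto simp: inner_cube_def mem_box_cart)

lemma inner_cube_borel [measurable]: "inner_cube \<delta> \<in> sets borel"
  by (simp add: inner_cube_box)

lemma open_unit_cube_eq: "open_unit_cube = inner_cube 0"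
  by (simp add: open_unit_cube_def inner_cube_def)

lemma inner_cube_subset: "0 \<le> \<delta> \<Longrightarrow> inner_cube \<delta> \<subseteq> open_unit_cube"
  by (auto simp: open_unit_cube_def inner_cube_def intro: order_le_less_trans less_le_trans)

lemma measure_inner_cube:
  assumes "\<delta> \<le> 1 / 2"
  shows "measure lborel (inner_cube \<delta> :: (real^'n) set) = (1 - 2 * \<delta>) ^ CARD('n)"
proof -
  have "measure lborel (inner_cube \<delta> :: (real^'n) set) = (\<Prod>b\<in>(Basis :: (real^'n) set). 1 - 2 * \<delta>)"
  proof -
    have eq: "((\<chi> i. 1 - \<delta>) - (\<chi> i. \<delta>)) \<bullet> b = 1 - 2 * \<delta>" if "b \<in> Basis" for b :: "real^'n"
      using that by (auto simp: Basis_vec_def inner_axis)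
    have le: "(\<chi> i. \<delta>) \<bullet> b \<le> (\<chi> i. 1 - \<delta>) \<bullet> b" if "b \<in> Basis" for b :: "real^'n"
      using that assms by (auto simp: Basis_vec_def inner_axis)
    show ?thesis
      unfolding inner_cube_box by (subst measure_lborel_box) (use le eq in \<open>auto intro!: prod.cong\<close>)
  qed
  then show ?thesis by simp
qed

locale strip_walk = simple_random_walk M X
  for M :: "'a measure" and X :: "nat \<Rightarrow> 'a \<Rightarrow> int" +
  fixes Y :: "nat \<Rightarrow> 'a \<Rightarrow> real^'n" and i0 :: 'n and \<nu> :: "real^'n \<Rightarrow> real"
  assumes indep_Y: "indep_vars (\<lambda>_. borel) Y UNIV"
    and distr_Y: "distr M borel (Y k) = uniform_measure lborel open_unit_cube"
    and indep_walk_Y: "indep_set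
      (sets (vimage_algebra (space M) (\<lambda>\<omega> n. walk X n \<omega>) (Pi\<^sub>M UNIV (\<lambda>_. count_space UNIV))))
      (sets (vimage_algebra (space M) (\<lambda>\<omega> n. Y n \<omega>) (Pi\<^sub>M UNIV (\<lambda>_. borel))))"
    and norm: "is_norm \<nu>"
begin

lemma measurable_Y [measurable]: "Y k \<in> borel_measurable M"
  using indep_Y by (auto simp: indep_vars_def)

lemmas measurable_norm [measurable] = borel_measurable_is_norm[OF norm]

lemmas measurable_ball [measurable] = norm_ball_borel[OF norm]

lemma prob_Y:
  assumes [measurable]: "A \<in> sets borel"
  shows "prob {\<omega> \<in> space M. Y k \<omega> \<in> A} = measure lborel (open_unit_cube \<inter> A)"
proof -
  have cube: "measure lborel (open_unit_cube :: (real^'n) set) = 1"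
    using measure_inner_cube[of 0, where ?'n = 'n] by (simp add: open_unit_cube_eq)
  have "emeasure lborel (open_unit_cube :: (real^'n) set) = 1"
    using cube by (subst emeasure_eq_ennreal_measure) (auto simp: measure_def)
  moreover have "prob {\<omega> \<in> space M. Y k \<omega> \<in> A} = measure (distr M borel (Y k)) A"
    by (subst measure_distr) (auto intro!: arg_cong[where f=prob])
  ultimately show ?thesis
    by (simp add: distr_Y measure_def emeasure_uniform_measure open_unit_cube_eq divide_ennreal_def)
qed

lemma AE_Y_cube: "AE \<omega> in M. \<forall>k. Y k \<omega> \<in> open_unit_cube"
proof (subst AE_all_countable, intro allI)
  fix k
  have "prob {\<omega> \<in> space M. Y k \<omega> \<in> open_unit_cube} = 1"
    using prob_Y[of open_unit_cube k] measure_inner_cube[of 0, where ?'n = 'n]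
    by (simp add: open_unit_cube_eq)
  then show "AE \<omega> in M. Y k \<omega> \<in> open_unit_cube"
    by (subst prob_Collect_eq_1[symmetric]) (auto simp: open_unit_cube_eq)
qed

abbreviation ball_volume :: "real \<Rightarrow> real" where
  "ball_volume \<epsilon> \<equiv> measure lborel (norm_ball \<nu> 0 1) * \<epsilon> ^ CARD('n)"

text \<open>Here \<open>K\<close> compares the given norm with the Euclidean one, which dominates each coordinate.\<close>

lemma norm_ball_subset_cube:
  assumes K: "0 < K" "\<And>x. norm x \<le> K * \<nu> x" and y: "y \<in> inner_cube (K * \<epsilon>)"
  shows "norm_ball \<nu> y \<epsilon> \<subseteq> open_unit_cube"
proof
  fix z assume "z \<in> norm_ball \<nu> y \<epsilon>"
  then have "K * \<nu> (z - y) < K * \<epsilon>"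
    using K(1) by (intro mult_strict_left_mono) (auto simp: norm_ball_def)
  then have "norm (z - y) < K * \<epsilon>" using K(2)[of "z - y"] by simp
  then have "\<bar>z $ i - y $ i\<bar> < K * \<epsilon>" for i
    using component_le_norm_cart[of "z - y" i] by simp
  moreover have "K * \<epsilon> < y $ i" "y $ i < 1 - K * \<epsilon>" for i using y by (auto simp: inner_cube_def)
  ultimately show "z \<in> open_unit_cube"
    unfolding open_unit_cube_def by (smt (verit) mem_Collect_eq)
qed

lemma prob_Y_avoids_ball:
  assumes K: "0 < K" "\<And>x. norm x \<le> K * \<nu> x" and y: "y \<in> inner_cube (K * \<epsilon>)" and "0 < \<epsilon>"
  shows "prob {\<omega> \<in> space M. Y k \<omega> \<notin> norm_ball \<nu> y \<epsilon>} = 1 - ball_volume \<epsilon>"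
proof -
  have "prob {\<omega> \<in> space M. Y k \<omega> \<in> norm_ball \<nu> y \<epsilon>} = ball_volume \<epsilon>"
    using norm_ball_subset_cube[OF K y]
    by (simp add: prob_Y Int_absorb1 measure_norm_ball[OF norm \<open>0 < \<epsilon>\<close>])
  then show ?thesis
    using prob_neg[of "\<lambda>\<omega>. Y k \<omega> \<in> norm_ball \<nu> y \<epsilon>"] by simp
qed

text \<open>Given \<open>Y 0\<close> in the inner cube, the other points avoid the ball independently, each with the
  same probability, whatever the value of \<open>Y 0\<close>; Fubini's theorem makes the conditioning precise.\<close>

lemma prob_Y_all_avoid_ball:
  assumes K: "0 < K" "\<And>x. norm x \<le> K * \<nu> x" and "0 < \<epsilon>"
    and J: "finite J" "0 \<notin> J"
  shows "prob {\<omega> \<in> space M. Y 0 \<omega> \<in> inner_cube (K * \<epsilon>) \<and> (\<forall>m\<in>J. Y m \<omega> \<notin> norm_ball \<nu> (Y 0 \<omega>) \<epsilon>)} =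
    prob {\<omega> \<in> space M. Y 0 \<omega> \<in> inner_cube (K * \<epsilon>)} * (1 - ball_volume \<epsilon>) ^ card J"
proof -
  define G where "G = (inner_cube (K * \<epsilon>) :: (real^'n) set)"
  define q where "q = 1 - ball_volume \<epsilon>"
  define U where "U \<omega> = restrict (\<lambda>i. Y i \<omega>) {0}" for \<omega>
  define V where "V \<omega> = restrict (\<lambda>i. Y i \<omega>) J" for \<omega>
  define PU where "PU = PiM {0::nat} (\<lambda>_. borel :: (real^'n) measure)"
  define PV where "PV = PiM J (\<lambda>_. borel :: (real^'n) measure)"
  define S where "S = {p \<in> space (PU \<Otimes>\<^sub>M PV). fst p 0 \<in> G \<and> (\<forall>m\<in>J. \<not> \<nu> (snd p m - fst p 0) < \<epsilon>)}"
  have [measurable]: "G \<in> sets borel" by (simp add: G_def)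
  have indep: "indep_var PU U PV V"
    unfolding PU_def PV_def U_def V_def by (rule indep_var_restrict[OF indep_Y]) (use J in auto)
  then have [measurable]: "U \<in> measurable M PU" "V \<in> measurable M PV"
    by (auto dest: indep_var_rv1 indep_var_rv2)
  interpret V: prob_space "distr M PV V" by (rule prob_space_distr) measurable
  have [measurable]: "S \<in> sets (PU \<Otimes>\<^sub>M PV)"
    using J(1) unfolding S_def PU_def PV_def by measurable
  have slice: "emeasure (distr M PV V) (Pair p -` S) = ennreal (q ^ card J) * indicator {p. p 0 \<in> G} p"
    if p: "p \<in> space PU" for p
  proof (cases "p 0 \<in> G")
    case True
    have sets: "Pair p -` S \<in> sets PV" by (rule sets_Pair1) measurable
    have "V -` (Pair p -` S) \<inter> space M = {\<omega> \<in> space M. \<forall>m\<in>J. Y m \<omega> \<notin> norm_ball \<nu> (p 0) \<epsilon>}"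
      using p True measurable_space[OF \<open>V \<in> measurable M PV\<close>]
      by (auto simp: S_def space_pair_measure V_def norm_ball_def)
    then have "emeasure (distr M PV V) (Pair p -` S) = prob {\<omega> \<in> space M. \<forall>m\<in>J. Y m \<omega> \<notin> norm_ball \<nu> (p 0) \<epsilon>}"
      using sets by (simp add: emeasure_distr emeasure_eq_measure)
    also have "prob {\<omega> \<in> space M. \<forall>m\<in>J. Y m \<omega> \<notin> norm_ball \<nu> (p 0) \<epsilon>} = q ^ card J"
    proof (cases "J = {}")
      case False
      have "prob (\<Inter>m\<in>J. Y m -` (- norm_ball \<nu> (p 0) \<epsilon>) \<inter> space M) =
          (\<Prod>m\<in>J. prob (Y m -` (- norm_ball \<nu> (p 0) \<epsilon>) \<inter> space M))"
        by (rule indep_varsD[OF indep_Y False J(1)]) auto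
      moreover have "(\<Inter>m\<in>J. Y m -` (- norm_ball \<nu> (p 0) \<epsilon>) \<inter> space M) =
          {\<omega> \<in> space M. \<forall>m\<in>J. Y m \<omega> \<notin> norm_ball \<nu> (p 0) \<epsilon>}"
        using False by auto
      moreover have "Y m -` (- norm_ball \<nu> (p 0) \<epsilon>) \<inter> space M = {\<omega> \<in> space M. Y m \<omega> \<notin> norm_ball \<nu> (p 0) \<epsilon>}" for m
        by auto
      ultimately show ?thesis
        using prob_Y_avoids_ball[OF K True[unfolded G_def] \<open>0 < \<epsilon>\<close>] by (simp add: q_def)
    qed (simp add: prob_space)
    finally show ?thesis using True by simp
  next
    case False
    then have "Pair p -` S = {}" by (auto simp: S_def)
    then show ?thesis using False by simp
  qed
  \<comment> \<open>If \<open>Y 0\<close> almost surely misses the inner cube, \<open>q\<close> may be negative, but then both sides vanish.\<close>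
  have q: "0 \<le> q ^ card J" if "prob {\<omega> \<in> space M. Y 0 \<omega> \<in> G} \<noteq> 0"
  proof -
    have "{\<omega> \<in> space M. Y 0 \<omega> \<in> G} \<noteq> {}" using that by (metis measure_empty)
    then obtain \<omega> where "Y 0 \<omega> \<in> inner_cube (K * \<epsilon>)" by (auto simp: G_def)
    from prob_Y_avoids_ball[OF K this \<open>0 < \<epsilon>\<close>, of 0] have "0 \<le> q"
      unfolding q_def by (metis measure_nonneg)
    then show ?thesis by simp
  qed
  have "ennreal (prob {\<omega> \<in> space M. Y 0 \<omega> \<in> G \<and> (\<forall>m\<in>J. Y m \<omega> \<notin> norm_ball \<nu> (Y 0 \<omega>) \<epsilon>)}) =
      emeasure (distr M (PU \<Otimes>\<^sub>M PV) (\<lambda>\<omega>. (U \<omega>, V \<omega>))) S"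
  proof -
    have "(\<lambda>\<omega>. (U \<omega>, V \<omega>)) -` S \<inter> space M =
        {\<omega> \<in> space M. Y 0 \<omega> \<in> G \<and> (\<forall>m\<in>J. Y m \<omega> \<notin> norm_ball \<nu> (Y 0 \<omega>) \<epsilon>)}"
      using measurable_space[OF \<open>U \<in> measurable M PU\<close>] measurable_space[OF \<open>V \<in> measurable M PV\<close>]
      by (auto simp: S_def space_pair_measure U_def V_def norm_ball_def)
    then show ?thesis
      by (subst emeasure_distr) (measurable, simp add: emeasure_eq_measure)
  qed
  also have "distr M (PU \<Otimes>\<^sub>M PV) (\<lambda>\<omega>. (U \<omega>, V \<omega>)) = distr M PU U \<Otimes>\<^sub>M distr M PV V"
    using indep by (simp add: indep_var_distribution_eq)
  also have "emeasure (distr M PU U \<Otimes>\<^sub>M distr M PV V) S =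
      (\<integral>\<^sup>+p. emeasure (distr M PV V) (Pair p -` S) \<partial>distr M PU U)"
    by (rule V.emeasure_pair_measure_alt) measurable
  also have "\<dots> = (\<integral>\<^sup>+p. ennreal (q ^ card J) * indicator {p. p 0 \<in> G} p \<partial>distr M PU U)"
    by (rule nn_integral_cong) (simp add: slice)
  also have "\<dots> = (\<integral>\<^sup>+p. ennreal (q ^ card J) * indicator {p \<in> space PU. p 0 \<in> G} p \<partial>distr M PU U)"
    by (rule nn_integral_cong) (simp add: indicator_def)
  also have "\<dots> = ennreal (q ^ card J) * emeasure (distr M PU U) {p \<in> space PU. p 0 \<in> G}"
    by (rule nn_integral_cmult_indicator) (simp add: PU_def)
  also have "emeasure (distr M PU U) {p \<in> space PU. p 0 \<in> G} = ennreal (prob {\<omega> \<in> space M. Y 0 \<omega> \<in> G})"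
  proof -
    have "U -` {p \<in> space PU. p 0 \<in> G} \<inter> space M = {\<omega> \<in> space M. Y 0 \<omega> \<in> G}"
      using measurable_space[OF \<open>U \<in> measurable M PU\<close>] by (auto simp: U_def)
    moreover have "{p \<in> space PU. p 0 \<in> G} \<in> sets PU" by (simp add: PU_def)
    ultimately show ?thesis by (simp add: emeasure_distr emeasure_eq_measure)
  qed
  finally show ?thesis
    unfolding G_def[symmetric] q_def[symmetric] using q
    by (cases "prob {\<omega> \<in> space M. Y 0 \<omega> \<in> G} = 0") (auto simp flip: ennreal_mult simp: mult.commute)
qed

definition no_return :: "real \<Rightarrow> nat \<Rightarrow> 'a set" where
  "no_return \<epsilon> n = {\<omega> \<in> space M. \<forall>m\<in>{1..n}. strip_process i0 X Y m \<omega> \<notin> norm_ball \<nu> (strip_process i0 X Y 0 \<omega>) \<epsilon>}"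

lemma measurable_strip_process [measurable]: "strip_process i0 X Y m \<in> borel_measurable M"
proof -
  note [measurable] = measurable_walk
  have [measurable]: "(\<lambda>\<omega>. axis i0 (real_of_int (walk X m \<omega>)) :: real^'n) \<in> borel_measurable M"
    by (rule measurable_compose[OF measurable_walk]) auto
  show ?thesis unfolding strip_process_def[abs_def] by measurable
qed

lemma no_return_events [measurable]: "no_return \<epsilon> n \<in> events"
  unfolding no_return_def norm_ball_def by measurable

lemma strip_process_0: "strip_process i0 X Y 0 \<omega> = Y 0 \<omega>"
  by (simp add: strip_process_def walk_def)

text \<open>A point of the unit cube leaves the cube when its first coordinate is shifted by a nonzero
  integer.\<close>

lemma strip_process_in_ball_iff:
  assumes K: "0 < K" "\<And>x. norm x \<le> K * \<nu> x"
    and "Y 0 \<omega> \<in> inner_cube (K * \<epsilon>)" "Y m \<omega> \<in> open_unit_cube"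
  shows "strip_process i0 X Y m \<omega> \<in> norm_ball \<nu> (Y 0 \<omega>) \<epsilon> \<longleftrightarrow>
    walk X m \<omega> = 0 \<and> Y m \<omega> \<in> norm_ball \<nu> (Y 0 \<omega>) \<epsilon>"
proof -
  have "walk X m \<omega> = 0" if "strip_process i0 X Y m \<omega> \<in> norm_ball \<nu> (Y 0 \<omega>) \<epsilon>"
  proof -
    have "strip_process i0 X Y m \<omega> \<in> open_unit_cube"
      using norm_ball_subset_cube[OF K assms(3)] that by blast
    then have "0 < real_of_int (walk X m \<omega>) + Y m \<omega> $ i0" "real_of_int (walk X m \<omega>) + Y m \<omega> $ i0 < 1"
      by (auto simp: open_unit_cube_def strip_process_def axis_def dest: spec[of _ i0])
    moreover have "0 < Y m \<omega> $ i0" "Y m \<omega> $ i0 < 1"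
      using assms(4) by (auto simp: open_unit_cube_def)
    ultimately show ?thesis by linarith
  qed
  moreover have "strip_process i0 X Y m \<omega> = Y m \<omega>" if "walk X m \<omega> = 0"
    using that by (simp add: strip_process_def)
  ultimately show ?thesis by auto
qed

text \<open>Split according to the set \<open>J\<close> of times at which the walk is at 0. On each piece, up to a null set,
  the event only involves \<open>Y 0\<close> and the points \<open>Y m\<close> with \<open>m \<in> J\<close>, and the independence of the walk and
  these points factorises its probability.\<close>

lemma prob_no_return_inner:
  assumes K: "0 < K" "\<And>x. norm x \<le> K * \<nu> x" and "0 < \<epsilon>"
  shows "prob {\<omega> \<in> no_return \<epsilon> n. Y 0 \<omega> \<in> inner_cube (K * \<epsilon>)} =
    prob {\<omega> \<in> space M. Y 0 \<omega> \<in> inner_cube (K * \<epsilon>)} * expectation (\<lambda>\<omega>. (1 - ball_volume \<epsilon>) ^ card (returns n \<omega>))"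
proof -
  note [measurable] = measurable_returns
  define q where "q = 1 - ball_volume \<epsilon>"
  define G where "G = {\<omega> \<in> space M. Y 0 \<omega> \<in> inner_cube (K * \<epsilon>)}"
  define R where "R J = {\<omega> \<in> space M. returns n \<omega> = J}" for J
  define A where "A J = {\<omega> \<in> space M. Y 0 \<omega> \<in> inner_cube (K * \<epsilon>) \<and> (\<forall>m\<in>J. Y m \<omega> \<notin> norm_ball \<nu> (Y 0 \<omega>) \<epsilon>)}" for J
  have R_ev [measurable]: "R J \<in> events" for J unfolding R_def by measurable
  have G_ev [measurable]: "G \<in> events" unfolding G_def by measurable
  have A_ev [measurable]: "A J \<in> events" if "finite J" for J
    using that unfolding A_def norm_ball_def by measurable
  have R_walk: "R J \<in> sets (vimage_algebra (space M) (\<lambda>\<omega> n. walk X n \<omega>) (Pi\<^sub>M UNIV (\<lambda>_. count_space UNIV)))"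
    if "J \<subseteq> {1..n}" for J
  proof -
    have "returns n \<omega> = J \<longleftrightarrow> (\<forall>m\<in>{1..n}. walk X m \<omega> = 0 \<longleftrightarrow> m \<in> J)" for \<omega>
      using that unfolding returns_def set_eq_iff by blast
    then have "R J = (\<lambda>\<omega> n. walk X n \<omega>) -` {w \<in> space (Pi\<^sub>M UNIV (\<lambda>_. count_space UNIV)). \<forall>m\<in>{1..n}. w m = 0 \<longleftrightarrow> m \<in> J} \<inter> space M"
      by (auto simp: R_def space_PiM)
    also have "\<dots> \<in> sets (vimage_algebra (space M) (\<lambda>\<omega> n. walk X n \<omega>) (Pi\<^sub>M UNIV (\<lambda>_. count_space UNIV)))"
      by (rule in_vimage_algebra) measurable
    finally show ?thesis .
  qed
  have A_Y: "A J \<in> sets (vimage_algebra (space M) (\<lambda>\<omega> n. Y n \<omega>) (Pi\<^sub>M UNIV (\<lambda>_. borel)))"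
    if "finite J" for J
  proof -
    have "A J = (\<lambda>\<omega> n. Y n \<omega>) -` {y \<in> space (Pi\<^sub>M UNIV (\<lambda>_. borel)). y 0 \<in> inner_cube (K * \<epsilon>) \<and> (\<forall>m\<in>J. \<not> \<nu> (y m - y 0) < \<epsilon>)} \<inter> space M"
      by (auto simp: A_def space_PiM norm_ball_def)
    also have "\<dots> \<in> sets (vimage_algebra (space M) (\<lambda>\<omega> n. Y n \<omega>) (Pi\<^sub>M UNIV (\<lambda>_. borel)))"
      using that by (intro in_vimage_algebra) measurable
    finally show ?thesis .
  qed
  have piece: "prob ({\<omega> \<in> no_return \<epsilon> n. Y 0 \<omega> \<in> inner_cube (K * \<epsilon>)} \<inter> R J) = prob G * (q ^ card J * prob (R J))"
    if J: "J \<in> Pow {1..n}" for J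
  proof -
    have fin: "finite J" "0 \<notin> J" using J finite_subset by auto
    have "prob ({\<omega> \<in> no_return \<epsilon> n. Y 0 \<omega> \<in> inner_cube (K * \<epsilon>)} \<inter> R J) = prob (R J \<inter> A J)"
    proof (rule finite_measure_eq_AE)
      have "{\<omega> \<in> no_return \<epsilon> n. Y 0 \<omega> \<in> inner_cube (K * \<epsilon>)} \<inter> R J = no_return \<epsilon> n \<inter> G \<inter> R J"
        by (auto simp: G_def no_return_def)
      then show "{\<omega> \<in> no_return \<epsilon> n. Y 0 \<omega> \<in> inner_cube (K * \<epsilon>)} \<inter> R J \<in> events" by simp
      show "R J \<inter> A J \<in> events" using fin by simp
      show "AE \<omega> in M. (\<omega> \<in> {\<omega> \<in> no_return \<epsilon> n. Y 0 \<omega> \<in> inner_cube (K * \<epsilon>)} \<inter> R J) = (\<omega> \<in> R J \<inter> A J)"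
        using AE_Y_cube
      proof eventually_elim
        case (elim \<omega>)
        show ?case
        proof (cases "\<omega> \<in> R J \<and> Y 0 \<omega> \<in> inner_cube (K * \<epsilon>)")
          case True
          then have J_eq: "J = {m \<in> {1..n}. walk X m \<omega> = 0}" by (auto simp: R_def returns_def)
          have "\<omega> \<in> no_return \<epsilon> n \<longleftrightarrow> \<omega> \<in> A J"
            using True elim strip_process_in_ball_iff[OF K, of \<omega> \<epsilon>]
            by (auto simp: no_return_def A_def strip_process_0 J_eq R_def)
          then show ?thesis using True by auto
        qed (auto simp: A_def)
      qed
    qed
    also have "\<dots> = prob (R J) * prob (A J)"
      by (rule indep_setD[OF indep_walk_Y]) (use J R_walk A_Y fin in auto)
    also have "prob (A J) = prob G * q ^ card J"
      unfolding A_def G_def q_def by (rule prob_Y_all_avoid_ball[OF K \<open>0 < \<epsilon>\<close> fin])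
    finally show ?thesis by simp
  qed
  have "{\<omega> \<in> no_return \<epsilon> n. Y 0 \<omega> \<in> inner_cube (K * \<epsilon>)} =
      (\<Union>J\<in>Pow {1..n}. {\<omega> \<in> no_return \<epsilon> n. Y 0 \<omega> \<in> inner_cube (K * \<epsilon>)} \<inter> R J)"
    by (auto simp: R_def no_return_def returns_def)
  also have "prob \<dots> = (\<Sum>J\<in>Pow {1..n}. prob ({\<omega> \<in> no_return \<epsilon> n. Y 0 \<omega> \<in> inner_cube (K * \<epsilon>)} \<inter> R J))"
  proof (rule finite_measure_finite_Union)
    have "{\<omega> \<in> no_return \<epsilon> n. Y 0 \<omega> \<in> inner_cube (K * \<epsilon>)} \<inter> R J = no_return \<epsilon> n \<inter> G \<inter> R J" for J
      by (auto simp: G_def no_return_def)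
    then show "(\<lambda>J. {\<omega> \<in> no_return \<epsilon> n. Y 0 \<omega> \<in> inner_cube (K * \<epsilon>)} \<inter> R J) ` Pow {1..n} \<subseteq> events"
      by auto
    show "disjoint_family_on (\<lambda>J. {\<omega> \<in> no_return \<epsilon> n. Y 0 \<omega> \<in> inner_cube (K * \<epsilon>)} \<inter> R J) (Pow {1..n})"
      by (auto simp: disjoint_family_on_def R_def)
  qed simp
  also have "\<dots> = prob G * (\<Sum>J\<in>Pow {1..n}. q ^ card J * prob (R J))"
    by (simp add: piece sum_distrib_left)
  also have "(\<Sum>J\<in>Pow {1..n}. q ^ card J * prob (R J)) = expectation (\<lambda>\<omega>. \<Sum>J\<in>Pow {1..n}. q ^ card J * indicator (R J) \<omega>)"
    by (subst Bochner_Integration.integral_sum) (auto simp: less_top[symmetric])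
  also have "\<dots> = expectation (\<lambda>\<omega>. q ^ card (returns n \<omega>))"
  proof (rule Bochner_Integration.integral_cong[OF refl])
    fix \<omega> assume "\<omega> \<in> space M"
    then have "(\<Sum>J\<in>Pow {1..n}. q ^ card J * indicator (R J) \<omega>) = (\<Sum>J\<in>Pow {1..n}. if J = returns n \<omega> then q ^ card J else 0)"
      by (intro sum.cong) (auto simp: R_def)
    also have "\<dots> = q ^ card (returns n \<omega>)"
      by (subst sum.delta) (auto simp: returns_def)
    finally show "(\<Sum>J\<in>Pow {1..n}. q ^ card J * indicator (R J) \<omega>) = q ^ card (returns n \<omega>)" .
  qed
  finally show ?thesis by (simp add: G_def q_def)
qed

end

section \<open>The return time\<close>

lemma return_time_le_iff:
  "return_time \<nu> Z \<epsilon> \<omega> \<le> enat n \<longleftrightarrow> (\<exists>m\<in>{1..n}. Z m \<omega> \<in> norm_ball \<nu> (Z 0 \<omega>) \<epsilon>)"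
proof
  assume le: "return_time \<nu> Z \<epsilon> \<omega> \<le> enat n"
  show "\<exists>m\<in>{1..n}. Z m \<omega> \<in> norm_ball \<nu> (Z 0 \<omega>) \<epsilon>"
  proof (rule ccontr)
    assume "\<not> ?thesis"
    then have "enat (Suc n) \<le> return_time \<nu> Z \<epsilon> \<omega>"
      unfolding return_time_def by (intro INF_greatest) (auto simp: not_less_eq_eq[symmetric])
    then have "enat (Suc n) \<le> enat n" using le by (rule order_trans)
    then show False by simp
  qed
next
  assume "\<exists>m\<in>{1..n}. Z m \<omega> \<in> norm_ball \<nu> (Z 0 \<omega>) \<epsilon>"
  then obtain m where "1 \<le> m" "m \<le> n" "Z m \<omega> \<in> norm_ball \<nu> (Z 0 \<omega>) \<epsilon>" by auto
  then show "return_time \<nu> Z \<epsilon> \<omega> \<le> enat n"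
    unfolding return_time_def by (intro INF_lower2[of m]) auto
qed

lemma scaled_sqrt_enat_le_iff:
  assumes a: "0 < a"
  shows "ereal a * sqrt_enat t \<le> ereal x \<longleftrightarrow> 0 \<le> x \<and> t \<le> enat (nat \<lfloor>(x / a)\<^sup>2\<rfloor>)"
proof (cases t)
  case (enat k)
  have "a * sqrt k \<le> x \<longleftrightarrow> 0 \<le> x \<and> real k \<le> (x / a)\<^sup>2"
  proof (cases "0 \<le> x")
    case True
    have "a * sqrt k \<le> x \<longleftrightarrow> sqrt k \<le> x / a" using a by (simp add: field_simps)
    also have "\<dots> \<longleftrightarrow> real k \<le> (x / a)\<^sup>2"
      using real_sqrt_le_iff[of "real k" "(x / a)\<^sup>2"] True a by simp
    finally show ?thesis using True by simp
  next
    case False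
    have "0 \<le> a * sqrt k" using a by simp
    then show ?thesis using False by linarith
  qed
  also have "real k \<le> (x / a)\<^sup>2 \<longleftrightarrow> k \<le> nat \<lfloor>(x / a)\<^sup>2\<rfloor>"
    by (simp add: le_nat_iff le_floor_iff)
  finally show ?thesis by (simp add: enat sqrt_enat_def)
next
  case infinity
  then show ?thesis using a by (simp add: sqrt_enat_def)
qed

context strip_walk
begin

lemma return_time_le_no_return:
  "{\<omega> \<in> space M. return_time \<nu> (strip_process i0 X Y) \<epsilon> \<omega> \<le> enat n} = space M - no_return \<epsilon> n"
  by (auto simp: return_time_le_iff no_return_def)

lemma measurable_return_time:
  "return_time \<nu> (strip_process i0 X Y) \<epsilon> \<in> measurable M (count_space UNIV)"
proof -
  define \<tau> where "\<tau> = return_time \<nu> (strip_process i0 X Y) \<epsilon>"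
  have le [measurable]: "{\<omega> \<in> space M. \<tau> \<omega> \<le> enat n} \<in> events" for n
    unfolding \<tau>_def return_time_le_no_return by measurable
  have "\<tau> \<in> measurable M (count_space UNIV)"
  proof (subst measurable_count_space_eq2_countable, intro conjI ballI)
    fix t :: enat
    show "\<tau> -` {t} \<inter> space M \<in> events"
    proof (cases t)
      case (enat k)
      have "\<tau> \<omega> = enat k \<longleftrightarrow> \<tau> \<omega> \<le> enat k \<and> (\<forall>j<k. \<not> \<tau> \<omega> \<le> enat j)" for \<omega>
        by (cases "\<tau> \<omega>") (auto simp: not_le intro: antisym leI)
      then have "\<tau> -` {t} \<inter> space M = {\<omega> \<in> space M. \<tau> \<omega> \<le> enat k \<and> (\<forall>j\<in>{..<k}. \<not> \<tau> \<omega> \<le> enat j)}"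
        using enat by (auto simp: vimage_def)
      also have "\<dots> \<in> events" by measurable
      finally show ?thesis .
    next
      case infinity
      have "\<tau> \<omega> = \<infinity> \<longleftrightarrow> (\<forall>j. \<not> \<tau> \<omega> \<le> enat j)" for \<omega>
        by (cases "\<tau> \<omega>") auto
      then have "\<tau> -` {t} \<inter> space M = {\<omega> \<in> space M. \<forall>j. \<not> \<tau> \<omega> \<le> enat j}"
        using infinity by (auto simp: vimage_def)
      also have "\<dots> \<in> events" by measurable
      finally show ?thesis .
    qed
  qed simp
  then show ?thesis by (simp add: \<tau>_def)
qed

text \<open>The error made by discarding the starting points near the boundary is at most their
  probability \<open>1 - g\<close>.\<close>

lemma prob_no_return_bounds:
  assumes K: "0 < K" "\<And>x. norm x \<le> K * \<nu> x" and \<epsilon>: "0 < \<epsilon>" "K * \<epsilon> \<le> 1 / 2"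
  defines "g \<equiv> (1 - 2 * (K * \<epsilon>)) ^ CARD('n)"
    and "e \<equiv> \<lambda>n. expectation (\<lambda>\<omega>. (1 - ball_volume \<epsilon>) ^ card (returns n \<omega>))"
  shows "g * e n \<le> prob (no_return \<epsilon> n)" "prob (no_return \<epsilon> n) \<le> g * e n + (1 - g)"
proof -
  define G where "G = {\<omega> \<in> space M. Y 0 \<omega> \<in> inner_cube (K * \<epsilon>)}"
  have [measurable]: "G \<in> events" unfolding G_def by measurable
  have inner: "inner_cube (K * \<epsilon>) \<subseteq> (open_unit_cube :: (real^'n) set)"
    using K(1) \<epsilon>(1) by (intro inner_cube_subset) simp
  have g: "prob G = g"
    using inner measure_inner_cube[of "K * \<epsilon>", where ?'n = 'n]
    \<epsilon>(2)
    by (simp add: G_def g_def prob_Y Int_absorb1)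
  have GN: "prob (no_return \<epsilon> n \<inter> G) = g * e n"
  proof -
    have "no_return \<epsilon> n \<inter> G = {\<omega> \<in> no_return \<epsilon> n. Y 0 \<omega> \<in> inner_cube (K * \<epsilon>)}"
      by (auto simp: G_def no_return_def)
    then show ?thesis
      using prob_no_return_inner[OF K \<epsilon>(1), of n] g by (simp add: G_def e_def)
  qed
  show "g * e n \<le> prob (no_return \<epsilon> n)"
    unfolding GN[symmetric] by (rule finite_measure_mono) auto
  have "prob (no_return \<epsilon> n) \<le> prob ((no_return \<epsilon> n \<inter> G) \<union> (space M - G))"
    using sets.sets_into_space[OF no_return_events] by (intro finite_measure_mono) auto
  also have "\<dots> \<le> prob (no_return \<epsilon> n \<inter> G) + prob (space M - G)"
    by (rule measure_Un_le) auto
  finally show "prob (no_return \<epsilon> n) \<le> g * e n + (1 - g)"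
    by (simp add: GN prob_compl g)
qed

lemma prob_no_return_tendsto:
  fixes \<epsilon> :: "nat \<Rightarrow> real" and n :: "nat \<Rightarrow> nat"
  assumes K: "0 < K" "\<And>x. norm x \<le> K * \<nu> x"
    and \<epsilon>: "\<And>i. 0 < \<epsilon> i" "\<And>i. K * \<epsilon> i \<le> 1 / 2" "\<And>i. ball_volume (\<epsilon> i) < 1" "\<epsilon> \<longlonglongrightarrow> 0"
    and n: "filterlim n at_top sequentially"
    and t: "0 < t" "(\<lambda>i. ball_volume (\<epsilon> i) * sqrt (n i)) \<longlonglongrightarrow> t"
  shows "(\<lambda>i. prob (no_return (\<epsilon> i) (n i))) \<longlonglongrightarrow> (\<integral>u. \<Phi> (u / t) - \<Phi> (- (u / t)) \<partial>exp_law)"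
proof -
  define g where "g i = (1 - 2 * (K * \<epsilon> i)) ^ CARD('n)" for i
  define e where "e i = expectation (\<lambda>\<omega>. (1 - ball_volume (\<epsilon> i)) ^ card (returns (n i) \<omega>))" for i
  have "(\<lambda>i. ball_volume (\<epsilon> i)) \<longlonglongrightarrow> measure lborel (norm_ball \<nu> 0 1) * 0 ^ CARD('n)"
    by (intro tendsto_intros \<epsilon>)
  then have "(\<lambda>i. ball_volume (\<epsilon> i)) \<longlonglongrightarrow> 0" by (simp add: power_0_left)
  then have e: "e \<longlonglongrightarrow> (\<integral>u. \<Phi> (u / t) - \<Phi> (- (u / t)) \<partial>exp_law)"
    unfolding e_def using \<epsilon>(1,3) t n measure_norm_ball_pos[OF norm]
    by (intro expectation_power_card_returns_tendsto) auto
  have "g \<longlonglongrightarrow> (1 - 2 * (K * 0)) ^ CARD('n)"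
    unfolding g_def by (intro tendsto_intros \<epsilon>)
  then have g: "g \<longlonglongrightarrow> 1" by simp
  show ?thesis
  proof (rule tendsto_sandwich)
    show "\<forall>\<^sub>F i in sequentially. g i * e i \<le> prob (no_return (\<epsilon> i) (n i))"
      "\<forall>\<^sub>F i in sequentially. prob (no_return (\<epsilon> i) (n i)) \<le> g i * e i + (1 - g i)"
      using prob_no_return_bounds[OF K \<epsilon>(1,2)] by (auto simp: g_def e_def)
    show "(\<lambda>i. g i * e i) \<longlonglongrightarrow> (\<integral>u. \<Phi> (u / t) - \<Phi> (- (u / t)) \<partial>exp_law)"
      using tendsto_mult[OF g e] by simp
    show "(\<lambda>i. g i * e i + (1 - g i)) \<longlonglongrightarrow> (\<integral>u. \<Phi> (u / t) - \<Phi> (- (u / t)) \<partial>exp_law)"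
      using tendsto_add[OF tendsto_mult[OF g e] tendsto_diff[OF tendsto_const[of 1] g]] by simp
  qed
qed

text \<open>The number of steps is \<open>\<lfloor>(t / (c \<epsilon>^d))\<^sup>2\<rfloor>\<close>, since this is how the event that the rescaled
  square root of the return time is at most \<open>t\<close> reads in terms of the return time.\<close>

lemma prob_return_time_tendsto:
  assumes t: "0 < t"
  shows "((\<lambda>\<epsilon>. prob {\<omega> \<in> space M. return_time \<nu> (strip_process i0 X Y) \<epsilon> \<omega> \<le> enat (nat \<lfloor>(t / ball_volume \<epsilon>)\<^sup>2\<rfloor>)})
    \<longlongrightarrow> 1 - (\<integral>u. \<Phi> (u / t) - \<Phi> (- (u / t)) \<partial>exp_law)) (at_right 0)"
proof -
  define c where "c = measure lborel (norm_ball \<nu> 0 1)"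
  have c: "0 < c" unfolding c_def by (rule measure_norm_ball_pos[OF norm])
  obtain K where K: "0 < K" "\<And>x. norm x \<le> K * \<nu> x" using norm_le_is_norm[OF norm] by blast
  \<comment> \<open>For \<open>\<epsilon> < b\<close> the boundary layer is thinner than half of the cube and \<open>c * \<epsilon> ^ d < 1\<close>.\<close>
  define b where "b = min (1 / (2 * K)) (min 1 (1 / c))"
  show ?thesis
  proof (rule tendsto_at_right_sequentially[where b=b])
    show "0 < b" using K(1) c by (simp add: b_def)
    fix \<epsilon> :: "nat \<Rightarrow> real"
    assume \<epsilon>: "\<And>i. 0 < \<epsilon> i" "\<And>i. \<epsilon> i < b" "\<epsilon> \<longlonglongrightarrow> 0"
    define a where "a i = ball_volume (\<epsilon> i)" for i
    define n where "n i = nat \<lfloor>(t / a i)\<^sup>2\<rfloor>" for i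
    have K\<epsilon>: "K * \<epsilon> i \<le> 1 / 2" for i
      using \<epsilon>(2)[of i] K(1) by (simp add: b_def field_simps)
    have a_pos: "0 < a i" for i using c \<epsilon>(1)[of i] by (simp add: a_def c_def)
    have a_less: "a i < 1" for i
    proof -
      have "\<epsilon> i ^ CARD('n) \<le> \<epsilon> i ^ 1"
        using \<epsilon>(1,2)[of i] by (intro power_decreasing) (auto simp: b_def Suc_le_eq)
      then have "a i \<le> c * \<epsilon> i" unfolding a_def c_def[symmetric] using c by (intro mult_left_mono) auto
      also have "\<dots> < 1" using \<epsilon>(2)[of i] c by (simp add: b_def field_simps)
      finally show ?thesis .
    qed
    have "a \<longlonglongrightarrow> c * 0 ^ CARD('n)"
      unfolding a_def c_def by (intro tendsto_intros \<epsilon>)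
    then have a0: "a \<longlonglongrightarrow> 0" by (simp add: power_0_left)
    have n_le: "real (n i) \<le> (t / a i)\<^sup>2" and n_ge: "(t / a i)\<^sup>2 < real (n i) + 1" for i
      unfolding n_def by (simp_all add: of_nat_nat floor_less_iff)
    have t_eq: "t\<^sup>2 = (a i)\<^sup>2 * (t / a i)\<^sup>2" for i
      using a_pos[of i] by (simp add: power_divide)
    have hi: "(a i)\<^sup>2 * n i \<le> t\<^sup>2" for i
      unfolding t_eq[of i] by (rule mult_left_mono[OF n_le]) simp
    have lo: "t\<^sup>2 - (a i)\<^sup>2 \<le> (a i)\<^sup>2 * n i" for i
    proof -
      have "t\<^sup>2 \<le> (a i)\<^sup>2 * (real (n i) + 1)"
        unfolding t_eq[of i] by (rule mult_left_mono[OF less_imp_le[OF n_ge]]) simp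
      then show ?thesis by (simp add: distrib_left)
    qed
    have "(\<lambda>i. t\<^sup>2 - (a i)\<^sup>2) \<longlonglongrightarrow> t\<^sup>2 - 0\<^sup>2" by (intro tendsto_intros a0)
    then have lower: "(\<lambda>i. t\<^sup>2 - (a i)\<^sup>2) \<longlonglongrightarrow> t\<^sup>2" by simp
    have "(\<lambda>i. (a i)\<^sup>2 * n i) \<longlonglongrightarrow> t\<^sup>2"
      by (rule tendsto_sandwich[OF always_eventually always_eventually lower tendsto_const]) (use lo hi in blast)+
    then have "(\<lambda>i. sqrt ((a i)\<^sup>2 * n i)) \<longlonglongrightarrow> sqrt (t\<^sup>2)" by (rule tendsto_real_sqrt)
    then have at: "(\<lambda>i. a i * sqrt (n i)) \<longlonglongrightarrow> t"
      using a_pos t by (simp add: real_sqrt_mult less_imp_le)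
    have n_top: "filterlim n at_top sequentially"
    proof -
      have "filterlim (\<lambda>i. t / a i) at_top sequentially"
        using a0 a_pos t by (intro LIM_at_top_divide[OF tendsto_const]) auto
      then have "filterlim (\<lambda>i. (t / a i)\<^sup>2) at_top sequentially"
        by (rule filterlim_pow_at_top[rotated]) simp
      then show ?thesis unfolding n_def
        by (rule filterlim_compose[OF filterlim_nat_sequentially filterlim_compose[OF filterlim_floor_sequentially]])
    qed
    have "(\<lambda>i. prob (no_return (\<epsilon> i) (n i))) \<longlonglongrightarrow> (\<integral>u. \<Phi> (u / t) - \<Phi> (- (u / t)) \<partial>exp_law)"
      using K \<epsilon>(1,3) K\<epsilon> a_less n_top t at unfolding a_def by (intro prob_no_return_tendsto) auto
    then have "(\<lambda>i. 1 - prob (no_return (\<epsilon> i) (n i))) \<longlonglongrightarrow> 1 - (\<integral>u. \<Phi> (u / t) - \<Phi> (- (u / t)) \<partial>exp_law)"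
      by (intro tendsto_intros)
    then show "(\<lambda>i. prob {\<omega> \<in> space M. return_time \<nu> (strip_process i0 X Y) (\<epsilon> i) \<omega> \<le> enat (nat \<lfloor>(t / ball_volume (\<epsilon> i))\<^sup>2\<rfloor>)})
        \<longlonglongrightarrow> 1 - (\<integral>u. \<Phi> (u / t) - \<Phi> (- (u / t)) \<partial>exp_law)"
      unfolding return_time_le_no_return by (simp add: prob_compl n_def a_def)
  qed
qed

end

theorem theorem2p2:
  fixes \<Omega> :: "'a measure"
    and X :: "nat \<Rightarrow> 'a \<Rightarrow> int"
    and Y :: "nat \<Rightarrow> 'a \<Rightarrow> real^'n"
    and i0 :: 'n
    and \<nu> :: "real^'n \<Rightarrow> real"
    and c :: real
    and P :: "'b measure"
    and E N :: "'b \<Rightarrow> real"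
  assumes "prob_space \<Omega>"
    and "prob_space.indep_vars \<Omega> (\<lambda>_. count_space UNIV) X {1..}"
    and "\<And>k. 1 \<le> k \<Longrightarrow> measure \<Omega> {\<omega> \<in> space \<Omega>. X k \<omega> = 1} = 1 / 2"
    and "\<And>k. 1 \<le> k \<Longrightarrow> measure \<Omega> {\<omega> \<in> space \<Omega>. X k \<omega> = - 1} = 1 / 2"
    and "prob_space.indep_vars \<Omega> (\<lambda>_. borel) Y UNIV"
    and "\<And>n. distr \<Omega> borel (Y n) = uniform_measure lborel open_unit_cube"
    and "prob_space.indep_set \<Omega>
           (sets (vimage_algebra (space \<Omega>) (\<lambda>\<omega> n. walk X n \<omega>)
              (Pi\<^sub>M UNIV (\<lambda>_. count_space UNIV))))
           (sets (vimage_algebra (space \<Omega>) (\<lambda>\<omega> n. Y n \<omega>)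
              (Pi\<^sub>M UNIV (\<lambda>_. borel))))"
    and "is_norm \<nu>"
    and "c = measure lborel (norm_ball \<nu> 0 1)"
    and "prob_space P"
    and "prob_space.indep_var P borel E borel N"
    and "distributed P lborel E (\<lambda>x. ennreal (exponential_density 1 x))"
    and "distributed P lborel N (\<lambda>x. ennreal (std_normal_density x))"
  shows "converges_in_distribution \<Omega>
           (\<lambda>\<epsilon> \<omega>. ereal (c * \<epsilon> ^ CARD('n)) *
                  sqrt_enat (return_time \<nu> (strip_process i0 X Y) \<epsilon> \<omega>))
           (distr P borel (\<lambda>\<omega>. E \<omega> / \<bar>N \<omega>\<bar>))
           (at_right 0)"
proof -
  interpret strip_walk \<Omega> X Y i0 \<nu>
    by (intro strip_walk.intro simple_random_walk.intro simple_random_walk_axioms.intro strip_walk_axioms.intro) (fact assms)+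
  have c: "0 < c" using measure_norm_ball_pos[OF norm] assms(9) by simp
  have pos: "0 < c * \<epsilon> ^ CARD('n)" if "0 < \<epsilon>" for \<epsilon> using that c by simp
  let ?Z = "\<lambda>\<epsilon> \<omega>. ereal (c * \<epsilon> ^ CARD('n)) * sqrt_enat (return_time \<nu> (strip_process i0 X Y) \<epsilon> \<omega>)"
  have meas: "?Z \<epsilon> \<in> borel_measurable \<Omega>" for \<epsilon>
    using measurable_compose[OF measurable_return_time, of "\<lambda>t. ereal (c * \<epsilon> ^ CARD('n)) * sqrt_enat t" borel]
    by simp
  have [measurable]: "E \<in> borel_measurable P" "N \<in> borel_measurable P"
    using assms(12,13) by (auto simp: distributed_def)
  have cdf: "cdf (distr P borel (\<lambda>\<omega>. E \<omega> / \<bar>N \<omega>\<bar>)) x = measure P {\<omega> \<in> space P. E \<omega> / \<bar>N \<omega>\<bar> \<le> x}" for x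
    unfolding cdf_def by (subst measure_distr) (auto intro!: arg_cong[where f="measure P"])
  have ev: "measure \<Omega> {\<omega> \<in> space \<Omega>. ?Z \<epsilon> \<omega> \<le> ereal x} =
      (if 0 < x then prob {\<omega> \<in> space \<Omega>. return_time \<nu> (strip_process i0 X Y) \<epsilon> \<omega> \<le> enat (nat \<lfloor>(x / ball_volume \<epsilon>)\<^sup>2\<rfloor>)} else 0)"
    if "0 < \<epsilon>" for \<epsilon> x
  proof (cases "0 < x")
    case True
    then show ?thesis
      unfolding scaled_sqrt_enat_le_iff[OF pos[OF that]] by (simp add: assms(9))
  next
    case False
    \<comment> \<open>The return time is at least 1, so the rescaled variable is positive.\<close>
    have "\<not> ?Z \<epsilon> \<omega> \<le> ereal x" for \<omega>
      using False return_time_le_iff[of \<nu> "strip_process i0 X Y" \<epsilon> \<omega> 0]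
      unfolding scaled_sqrt_enat_le_iff[OF pos[OF that]] by (cases "x = 0") auto
    then show ?thesis using False by simp
  qed
  have "((\<lambda>\<epsilon>. measure \<Omega> {\<omega> \<in> space \<Omega>. ?Z \<epsilon> \<omega> \<le> ereal x}) \<longlongrightarrow>
      cdf (distr P borel (\<lambda>\<omega>. E \<omega> / \<bar>N \<omega>\<bar>)) x) (at_right 0)" for x
  proof (rule Lim_transform_eventually)
    show "\<forall>\<^sub>F \<epsilon> in at_right 0.
      (if 0 < x then prob {\<omega> \<in> space \<Omega>. return_time \<nu> (strip_process i0 X Y) \<epsilon> \<omega> \<le> enat (nat \<lfloor>(x / ball_volume \<epsilon>)\<^sup>2\<rfloor>)} else 0) =
      measure \<Omega> {\<omega> \<in> space \<Omega>. ?Z \<epsilon> \<omega> \<le> ereal x}"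
      using eventually_at_right_less[of "0::real"] by eventually_elim (simp only: ev)
    show "((\<lambda>\<epsilon>. if 0 < x then prob {\<omega> \<in> space \<Omega>. return_time \<nu> (strip_process i0 X Y) \<epsilon> \<omega> \<le> enat (nat \<lfloor>(x / ball_volume \<epsilon>)\<^sup>2\<rfloor>)} else 0)
      \<longlongrightarrow> cdf (distr P borel (\<lambda>\<omega>. E \<omega> / \<bar>N \<omega>\<bar>)) x) (at_right 0)"
      unfolding cdf using prob_ratio_exponential_normal[OF assms(10-13), of x] prob_return_time_tendsto[of x]
      by (cases "0 < x") auto
  qed
  then show ?thesis
    unfolding converges_in_distribution_def using meas by simp
qed

end
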